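(* Let $F$ be a field of characteristic $0$, let $M_2(F)$ be the algebra of $2\times 2$ matrices and $\mathrm{UT}_2(F)$ the algebra of upper triangular $2\times 2$ matrices over $F$. Let $A = M_2(F)\oplus \mathrm{UT}_2(F)$ (direct sum of ideals), and define a $T_1$-grading on $A$ by $A^{(0)}=(M_2(F),0)$, $A^{(1)}=\lbrace (\varphi(a), a) \mid a \in \mathrm{UT}_2(F) \rbrace$, where $\varphi \colon \mathrm{UT}_2(F) \hookrightarrow M_2(F)$ is the natural embedding and $T_1=\lbrace 0,1\rbrace$ is the multiplicative semigroup of the field $\mathbb Z_2$. Then the limit $\lim_{n\to \infty} \sqrt[n]{c_n^{T_1\text{-}\mathrm{gr}}(A)}$ exists and equals $4+2\sqrt 2= 6.8284\ldots$
   Context: For a semigroup $T$, an algebra $A$ is $T$-graded if $A=\bigoplus_{t\in T}A^{(t)}$ (direct sum of subspaces) with $A^{(h)}A^{(t)}\subseteq A^{(ht)}$ for all $h,t\in T$. Graded codimensions: let $F\langle X^{T\text{-}\mathrm{gr}}\rangle$ be the free associative algebra (non-commutative polynomials) on the variables $x^{(t)}_i$, $t\in T$, $i\in\mathbb N$. A polynomial $f(x^{(t_1)}_{i_1},\dots,x^{(t_s)}_{i_s})$ is a graded polynomial identity of the $T$-graded algebra $A$ if it vanishes whenever each $x^{(t_j)}_{i_j}$ is replaced by an arbitrary element of $A^{(t_j)}$; the set of all of them is the ideal $\mathrm{Id}^{T\text{-}\mathrm{gr}}(A)$. Let $P^{T\text{-}\mathrm{gr}}_n$ be the $F$-linear span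 of all monomials $x^{(t_1)}_{\sigma(1)}x^{(t_2)}_{\sigma(2)}\cdots x^{(t_n)}_{\sigma(n)}$ with $t_i\in T$, $\sigma\in S_n$. The $n$th graded codimension is $c^{T\text{-}\mathrm{gr}}_n(A)=\dim_F\bigl(P^{T\text{-}\mathrm{gr}}_n/(P^{T\text{-}\mathrm{gr}}_n\cap \mathrm{Id}^{T\text{-}\mathrm{gr}}(A))\bigr)$. *)

theory Defs
  imports
    "HOL-Analysis.Analysis"
    "HOL-Library.Z2"
    "HOL-Library.Poly_Mapping"
    "HOL-Library.Set_Algebras"
    "Jordan_Normal_Form.VS_Connect"
begin

no_notation Matrix.vec_index (infixl "$" 100)

section \<open>Quotients of vector spaces\<close>

text \<open>
  The quotient \<open>V / W\<close> of subspaces \<open>W \<subseteq> V\<close> of a type-based vector space, as a module record, so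
  that \<^const>\<open>vectorspace.dim\<close> applies to it. Its elements are the cosets \<open>v + W\<close>. The record fields
  for a multiplication and a unit play no role for modules. Adding \<open>W\<close> in the scalar
  multiplication matters only for the scalar \<open>0\<close>, where the image of a coset is just \<open>{0}\<close>.
\<close>

definition quotient_space ::
    "('a \<Rightarrow> 'v::ab_group_add \<Rightarrow> 'v) \<Rightarrow> 'v set \<Rightarrow> 'v set \<Rightarrow> ('a, 'v set) module" where
  "quotient_space scl V W =
     \<lparr>carrier = (\<lambda>v. v +o W) ` V, mult = undefined, one = undefined, zero = W, add = (+),
      smult = (\<lambda>c X. scl c ` X + W)\<rparr>"

lemma vectorspace_quotient_space:
  fixes scl :: "'a::field \<Rightarrow> 'v::ab_group_add \<Rightarrow> 'v"
  assumes "vector_space scl"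
    and V: "Modules.module.subspace scl V" and W: "Modules.module.subspace scl W"
  shows "vectorspace class_ring (quotient_space scl V W)"
proof -
  interpret vector_space scl by fact
  have WW: "W + W = W"
    using subspace_0[OF W] subspace_add[OF W] by (force simp: set_plus_def)
  have add: "(x +o W) + (y +o W) = (x + y) +o W" for x y
    by (simp add: set_plus_rearrange WW)
  have smult: "scl c ` (x +o W) + W = scl c x +o W" for c x
  proof
    show "scl c ` (x +o W) + W \<subseteq> scl c x +o W"
      using subspace_add[OF W] subspace_scale[OF W]
      by (force simp: set_plus_def elt_set_plus_def scale_right_distrib add.assoc)
    show "scl c x +o W \<subseteq> scl c ` (x +o W) + W"
      using subspace_0[OF W] by (force simp: set_plus_def elt_set_plus_def)
  qed
  have W0: "W = 0 +o W" by simp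
  have addW: "W + (x +o W) = x +o W" "(x +o W) + W = x +o W" for x
    by (metis W0 add add_0_left add_0_right)+
  have "abelian_group (quotient_space scl V W)"
  proof (rule abelian_groupI)
    fix X assume "X \<in> carrier (quotient_space scl V W)"
    then obtain x where x: "x \<in> V" "X = x +o W" by (auto simp: quotient_space_def)
    then have "(- x +o W) + X = W" by (simp add: add)
    moreover have "- x \<in> V" using subspace_neg[OF V x(1)] .
    ultimately show "\<exists>Y\<in>carrier (quotient_space scl V W).
        Y \<oplus>\<^bsub>quotient_space scl V W\<^esub> X = \<zero>\<^bsub>quotient_space scl V W\<^esub>"
      by (auto simp: quotient_space_def)
  qed (use subspace_0[OF V] subspace_add[OF V] W0 in
        \<open>auto simp: quotient_space_def add addW ac_simps intro: image_eqI[where x = 0]\<close>)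
  moreover have "cring (class_ring :: 'a ring)" by (rule class_cring.is_cring)
  ultimately have "Module.module class_ring (quotient_space scl V W)"
    using subspace_scale[OF V]
    by (intro Module.module.intro Module.module_axioms.intro)
       (auto simp: quotient_space_def add smult addW
         simp del: scale_left_distrib scale_right_distrib,
        simp_all add: scale_left_distrib scale_right_distrib)
  then show ?thesis by (simp add: vectorspace_def class_field)
qed


section \<open>Graded algebras and graded codimensions\<close>

text \<open>
  An algebra is given by a subspace \<open>A\<close> of a type-based vector space and a product that only needs
  to behave well on \<open>A\<close>. It need not be unital.
\<close>

locale graded_algebra = vector_space scl
  for scl :: "'a::field \<Rightarrow> 'v::ab_group_add \<Rightarrow> 'v" +
  fixes mul :: "'v \<Rightarrow> 'v \<Rightarrow> 'v" and A :: "'v set"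
    and G :: "'t::semigroup_mult \<Rightarrow> 'v set"
  assumes subspace_A: "subspace A"
    and mul_closed: "x \<in> A \<Longrightarrow> y \<in> A \<Longrightarrow> mul x y \<in> A"
    and mul_assoc: "x \<in> A \<Longrightarrow> y \<in> A \<Longrightarrow> z \<in> A \<Longrightarrow> mul (mul x y) z = mul x (mul y z)"
    and mul_add_left: "x \<in> A \<Longrightarrow> y \<in> A \<Longrightarrow> z \<in> A \<Longrightarrow> mul (x + y) z = mul x z + mul y z"
    and mul_add_right: "x \<in> A \<Longrightarrow> y \<in> A \<Longrightarrow> z \<in> A \<Longrightarrow> mul x (y + z) = mul x y + mul x z"
    and mul_scale_left: "x \<in> A \<Longrightarrow> y \<in> A \<Longrightarrow> mul (scl c x) y = scl c (mul x y)"
    and mul_scale_right: "x \<in> A \<Longrightarrow> y \<in> A \<Longrightarrow> mul x (scl c y) = scl c (mul x y)"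
    and subspace_G: "subspace (G t)"
    and G_subset: "G t \<subseteq> A"
    and direct_sum: "a \<in> A \<Longrightarrow>
      \<exists>!f. (\<forall>t. f t \<in> G t) \<and> finite {t. f t \<noteq> 0} \<and> a = (\<Sum>t | f t \<noteq> 0. f t)"
    and mul_G: "x \<in> G h \<Longrightarrow> y \<in> G t \<Longrightarrow> mul x y \<in> G (h * t)"

text \<open>
  The variable \<open>x\<^sub>i\<^sup>(\<^sup>t\<^sup>)\<close> is the pair \<open>(t, i)\<close>. A non-commutative polynomial is a finitely supported
  function on words; the free (non-unital) associative algebra consists of those without constant
  term. Its product, which extends concatenation of words, is not needed below.
\<close>

type_synonym ('t, 'a) gr_poly = "('t \<times> nat) list \<Rightarrow>\<^sub>0 'a"

definition poly_scale :: "'a::field \<Rightarrow> ('t, 'a) gr_poly \<Rightarrow> ('t, 'a) gr_poly" where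
  "poly_scale c f = Poly_Mapping.map ((*) c) f"

definition free_algebra :: "('t, 'a::field) gr_poly set" where
  "free_algebra = {f. Poly_Mapping.lookup f [] = 0}"

text \<open>The value on the empty word is a dummy: constant terms are excluded.\<close>

fun eval_word :: "('v \<Rightarrow> 'v \<Rightarrow> 'v) \<Rightarrow> ('x \<Rightarrow> 'v::zero) \<Rightarrow> 'x list \<Rightarrow> 'v" where
  "eval_word mul e [] = 0"
| "eval_word mul e [x] = e x"
| "eval_word mul e (x # y # w) = mul (e x) (eval_word mul e (y # w))"

definition eval_poly ::
    "('a::field \<Rightarrow> 'v::ab_group_add \<Rightarrow> 'v) \<Rightarrow> ('v \<Rightarrow> 'v \<Rightarrow> 'v) \<Rightarrow> ('t \<times> nat \<Rightarrow> 'v) \<Rightarrow>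
     ('t, 'a) gr_poly \<Rightarrow> 'v" where
  "eval_poly scl mul e f = (\<Sum>w\<in>Poly_Mapping.keys f. scl (Poly_Mapping.lookup f w) (eval_word mul e w))"

definition graded_identities ::
    "('a::field \<Rightarrow> 'v::ab_group_add \<Rightarrow> 'v) \<Rightarrow> ('v \<Rightarrow> 'v \<Rightarrow> 'v) \<Rightarrow> ('t \<Rightarrow> 'v set) \<Rightarrow>
     ('t, 'a) gr_poly set" where
  "graded_identities scl mul G =
     {f \<in> free_algebra. \<forall>e. (\<forall>t i. e (t, i) \<in> G t) \<longrightarrow> eval_poly scl mul e f = 0}"

definition graded_multilinear :: "nat \<Rightarrow> ('t, 'a::field) gr_poly set" where
  "graded_multilinear n = Modules.module.span poly_scale
     {Poly_Mapping.single (map (\<lambda>j. (t j, \<sigma> j)) [1..<Suc n]) 1 | t \<sigma>. \<sigma> permutes {1..n}}"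

text \<open>
  The dimension is the intended one whenever it is finite, in particular for every finite grading
  semigroup.
\<close>

definition graded_codim ::
    "('a::field \<Rightarrow> 'v::ab_group_add \<Rightarrow> 'v) \<Rightarrow> ('v \<Rightarrow> 'v \<Rightarrow> 'v) \<Rightarrow> ('t \<Rightarrow> 'v set) \<Rightarrow> nat \<Rightarrow> nat" where
  "graded_codim scl mul G n = vectorspace.dim (class_ring :: 'a ring)
     (quotient_space poly_scale (graded_multilinear n)
        (graded_multilinear n \<inter> graded_identities scl mul G))"

lemma vector_space_poly_scale: "vector_space poly_scale"
proof -
  have *: "Poly_Mapping.lookup (poly_scale c f) w = c * Poly_Mapping.lookup f w" for c f w
    by (simp add: poly_scale_def Poly_Mapping.map.rep_eq when_def)
  show ?thesis
    by standard (auto intro!: poly_mapping_eqI simp: * lookup_add algebra_simps)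
qed


section \<open>The algebra \<open>M\<^sub>2(F) \<oplus> UT\<^sub>2(F)\<close> and its grading\<close>

text \<open>
  \<open>UT\<^sub>2(F)\<close> is a subset of \<open>M\<^sub>2(F)\<close>, so its natural embedding into \<open>M\<^sub>2(F)\<close> is the identity on it.
  The grading semigroup, the multiplicative semigroup of the field with two elements, is the type
  \<^typ>\<open>bit\<close> with its multiplication. The product of matrices is \<open>**\<close>, since \<open>*\<close> is componentwise.
\<close>

definition UT2 :: "('a::field ^ 2 ^ 2) set" where
  "UT2 = {m. m $ 2 $ 1 = 0}"

definition M2_UT2 :: "(('a::field ^ 2 ^ 2) \<times> ('a ^ 2 ^ 2)) set" where
  "M2_UT2 = UNIV \<times> UT2"

definition pair_scale ::
    "'a::field \<Rightarrow> ('a ^ 2 ^ 2) \<times> ('a ^ 2 ^ 2) \<Rightarrow> ('a ^ 2 ^ 2) \<times> ('a ^ 2 ^ 2)" where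
  "pair_scale c x = (map_matrix ((*) c) (fst x), map_matrix ((*) c) (snd x))"

definition pair_mult ::
    "('a::field ^ 2 ^ 2) \<times> ('a ^ 2 ^ 2) \<Rightarrow> ('a ^ 2 ^ 2) \<times> ('a ^ 2 ^ 2) \<Rightarrow>
     ('a ^ 2 ^ 2) \<times> ('a ^ 2 ^ 2)" where
  "pair_mult x y = (fst x ** fst y, snd x ** snd y)"

definition T1_gr :: "bit \<Rightarrow> (('a::field ^ 2 ^ 2) \<times> ('a ^ 2 ^ 2)) set" where
  "T1_gr t = (if t = 0 then UNIV \<times> {0} else {(a, a) | a. a \<in> UT2})"

lemma graded_algebra_M2_UT2: "graded_algebra pair_scale pair_mult M2_UT2 T1_gr"
proof -
  note defs = pair_scale_def pair_mult_def M2_UT2_def UT2_def T1_gr_def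
  have gr_iff: "x \<in> T1_gr t \<longleftrightarrow>
      (if t = 0 then snd x = 0 else fst x = snd x \<and> snd x $ 2 $ 1 = 0)"
    for t and x :: "('a ^ 2 ^ 2) \<times> ('a ^ 2 ^ 2)"
    by (cases x) (auto simp: defs)
  have A_iff: "x \<in> M2_UT2 \<longleftrightarrow> snd x $ 2 $ 1 = 0" for x :: "('a ^ 2 ^ 2) \<times> ('a ^ 2 ^ 2)"
    by (cases x) (auto simp: defs)
  interpret vector_space "pair_scale :: 'a \<Rightarrow> _"
    by standard (auto simp: defs map_matrix_def prod_eq_iff Finite_Cartesian_Product.vec_eq_iff algebra_simps)
  show ?thesis
  proof
    fix a :: "('a ^ 2 ^ 2) \<times> ('a ^ 2 ^ 2)"
    assume a: "a \<in> M2_UT2"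
    let ?P = "\<lambda>f. (\<forall>t. f t \<in> T1_gr t) \<and> finite {t. f t \<noteq> 0} \<and> a = (\<Sum>t | f t \<noteq> 0. f t)"
    have UNIV_bit: "(UNIV :: bit set) = {0, 1}" by (auto intro: bit.exhaust)
    then have fin: "finite S" for S :: "bit set"
      by (metis finite.emptyI finite.insertI finite_subset top_greatest)
    have sum_bit: "(\<Sum>t | f t \<noteq> 0. f t) = f 0 + f 1"
      for f :: "bit \<Rightarrow> ('a ^ 2 ^ 2) \<times> ('a ^ 2 ^ 2)"
    proof -
      have "(\<Sum>t | f t \<noteq> 0. f t) = (\<Sum>t\<in>UNIV. f t)"
        by (rule sum.mono_neutral_left) (auto simp: fin)
      then show ?thesis by (simp add: UNIV_bit)
    qed
    show "\<exists>!f. ?P f"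
    proof (rule ex1I)
      let ?f = "\<lambda>t::bit. if t = 0 then (fst a - snd a, 0) else (snd a, snd a)"
      show "?P ?f"
        using a unfolding sum_bit by (auto simp: fin defs prod_eq_iff)
    next
      fix g :: "bit \<Rightarrow> _" assume g: "?P g"
      then have g0: "g 0 \<in> T1_gr 0" and g1: "g 1 \<in> T1_gr 1" and s: "a = g 0 + g 1"
        by (auto simp: sum_bit)
      show "g = (\<lambda>t. if t = 0 then (fst a - snd a, 0) else (snd a, snd a))"
      proof
        fix t :: bit
        show "g t = (if t = 0 then (fst a - snd a, 0) else (snd a, snd a))"
          using g0 g1 s by (cases t) (auto simp: defs)
      qed
    qed
  qed (auto simp: subspace_def gr_iff A_iff pair_scale_def pair_mult_def matrix_mul_assoc matrix_add_ldistrib matrix_matrix_mult_def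
      map_matrix_def prod_eq_iff Finite_Cartesian_Product.vec_eq_iff sum_2 algebra_simps split: if_splits)
qed

end

theory Submission
  imports Defs "HOL-Combinatorics.Cycles" "HOL-Real_Asymp.Real_Asymp"
begin

text \<open>
  Evaluate multilinear polynomials at matrix units. A product of matrix units vanishes unless the
  numbers of factors \<open>e\<^sub>1\<^sub>2\<close> and \<open>e\<^sub>2\<^sub>1\<close> differ by at most one. A variable of degree \<open>0\<close> can take four
  units and one of degree \<open>1\<close> only three (not \<open>e\<^sub>2\<^sub>1\<close>), so the codimension is bounded by the
  coefficients of \<open>x\<^sup>0\<close> and \<open>x\<^sup>\<plusminus>\<^sup>1\<close> in \<open>(4 + 2x + 1/x)\<^sup>n\<close>, hence, taking \<open>x = 1/\<surd>2\<close>, by a multiple of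
  \<open>(4 + 2\<surd>2)\<^sup>n\<close>.

  For the lower bound, three additional variables of degree \<open>0\<close> evaluated at \<open>e\<^sub>1\<^sub>1, e\<^sub>1\<^sub>2, e\<^sub>2\<^sub>1\<close> turn
  products of traces of words, indexed by the permutations in \<open>S\<^sub>n\<close>, into values of polynomials. At
  an assignment of matrix units with rows \<open>r\<close> and columns \<open>c\<close>, the product belonging to \<open>\<sigma>\<close> is \<open>1\<close> if
  \<open>c = r \<circ> \<sigma>\<close> and \<open>0\<close> otherwise. Alternating over disjoint transpositions, as in the construction of
  polytabloids, gives a family dual to the assignments that have equally many indices \<open>1\<close> and
  \<open>2\<close>, both among the rows and among the columns, in each block of variables of length \<open>2h\<close>. Each
  such block can be filled in at least \<open>(4 + 2\<surd>2)\<^sup>2\<^sup>h / (2h(h + 1))\<close> ways.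
\<close>

section \<open>Dimension of a quotient\<close>

context
  fixes scl :: "'a::field \<Rightarrow> 'v::ab_group_add \<Rightarrow> 'v" and V W :: "'v set"
  assumes vs: "vector_space scl"
    and V: "Modules.module.subspace scl V" and W: "Modules.module.subspace scl W"
begin

interpretation vector_space scl by (rule vs)

lemma add_quotient_space: "(x +o W) + (y +o W) = (x + y) +o W"
proof -
  have "W + W = W"
    using subspace_0[OF W] subspace_add[OF W] by (force simp: set_plus_def)
  then show ?thesis by (simp add: set_plus_rearrange)
qed

lemma scale_quotient_space: "scl c ` (x +o W) + W = scl c x +o W"
proof
  show "scl c ` (x +o W) + W \<subseteq> scl c x +o W"
    using subspace_add[OF W] subspace_scale[OF W]
    by (force simp: set_plus_def elt_set_plus_def scale_right_distrib add.assoc)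
  show "scl c x +o W \<subseteq> scl c ` (x +o W) + W"
    using subspace_0[OF W] by (force simp: set_plus_def elt_set_plus_def)
qed

interpretation Q: vectorspace "class_ring :: 'a ring" "quotient_space scl V W"
  by (rule vectorspace_quotient_space[OF vs V W])

lemma carrier_quotient_space: "carrier (quotient_space scl V W) = (\<lambda>v. v +o W) ` V"
  by (simp add: quotient_space_def)

lemma quotient_space_ops:
  "(x +o W) \<oplus>\<^bsub>quotient_space scl V W\<^esub> (y +o W) = (x + y) +o W"
  "c \<odot>\<^bsub>quotient_space scl V W\<^esub> (x +o W) = scl c x +o W"
  "\<zero>\<^bsub>quotient_space scl V W\<^esub> = W"
  using add_quotient_space scale_quotient_space by (simp_all add: quotient_space_def)

lemma coset_eq_iff: "x +o W = y +o W \<longleftrightarrow> x - y \<in> W"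
proof
  assume "x +o W = y +o W"
  moreover have "x \<in> x +o W" using subspace_0[OF W] by (force simp: elt_set_plus_def)
  ultimately show "x - y \<in> W" by (auto simp: elt_set_plus_def)
next
  assume *: "x - y \<in> W"
  have "W = (x - y) +o W"
  proof
    show "W \<subseteq> (x - y) +o W"
    proof
      fix z assume "z \<in> W"
      then have "z - (x - y) \<in> W" using * by (rule subspace_diff[OF W])
      moreover have "z = (x - y) + (z - (x - y))" by simp
      ultimately show "z \<in> (x - y) +o W" unfolding elt_set_plus_def by blast
    qed
    show "(x - y) +o W \<subseteq> W" using subspace_add[OF W *] by (auto simp: elt_set_plus_def)
  qed
  then have "y +o W = y +o ((x - y) +o W)" by simp
  then show "x +o W = y +o W" by (simp add: set_plus_rearrange2)
qed

lemma dim_quotient_space_le_spanning: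
  assumes B: "finite B" "B \<subseteq> V" "V \<subseteq> span (B \<union> W)"
  shows "Q.fin_dim" "Q.dim \<le> card B"
proof -
  let ?B = "(\<lambda>v. v +o W) ` B"
  have sub: "?B \<subseteq> carrier (quotient_space scl V W)"
    using B(2) by (auto simp: carrier_quotient_space)
  interpret S: submodule "class_ring :: 'a ring" "Q.span ?B" "quotient_space scl V W"
    by (rule Q.span_is_submodule[OF sub])
  have W0: "0 +o W = W" by simp
  have "v +o W \<in> Q.span ?B" if "v \<in> V" for v
  proof -
    from that B(3) have "v \<in> span (B \<union> W)" by auto
    then show ?thesis
    proof (induction rule: span_induct_alt)
      case base
      show ?case using S.zero_closed by (simp add: quotient_space_ops)
    next
      case (step c x y)
      have "x +o W \<in> Q.span ?B"
      proof (cases "x \<in> B")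
        case True
        then show ?thesis using Q.in_own_span[OF sub] by auto
      next
        case False
        then have "x - 0 \<in> W" using step by simp
        then have "x +o W = W" by (simp only: coset_eq_iff[symmetric]) simp
        then show ?thesis using S.zero_closed by (simp add: quotient_space_ops)
      qed
      from S.m_closed[OF S.smult_closed[OF _ this, of c] step(2)]
      show ?case by (simp add: quotient_space_ops)
    qed
  qed
  then have gen: "Q.gen_set ?B"
    using Q.span_is_subset2[OF sub] by (auto simp: carrier_quotient_space)
  then show "Q.fin_dim" using sub B(1) unfolding Q.fin_dim_def by blast
  have "Q.dim \<le> card ?B" using Q.gen_ge_dim[OF _ sub gen] B(1) by simp
  also have "\<dots> \<le> card B" by (rule card_image_le[OF B(1)])
  finally show "Q.dim \<le> card B" .
qed

text \<open>Functionals vanishing on \<open>W\<close> are constant on cosets, so a dual family makes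
  the cosets of the \<open>f s\<close> independent. \<open>fd\<close> is assumed because
  \<open>Q.dim\<close> bounds independent sets only in finite dimension.\<close>

lemma dim_quotient_space_ge:
  assumes fd: "Q.fin_dim" and S: "finite S" and f: "\<And>s. s \<in> S \<Longrightarrow> f s \<in> V"
    and lin: "\<And>s. s \<in> S \<Longrightarrow> Vector_Spaces.linear scl (*) (\<phi> s)"
    and van: "\<And>s w. s \<in> S \<Longrightarrow> w \<in> W \<Longrightarrow> \<phi> s w = (0 :: 'a)"
    and dual: "\<And>s s'. s \<in> S \<Longrightarrow> s' \<in> S \<Longrightarrow> \<phi> s (f s') = of_bool (s = s')"
  shows "card S \<le> Q.dim"
proof -
  let ?c = "\<lambda>s. f s +o W"
  have inj: "inj_on ?c S"
  proof
    fix s s' assume *: "s \<in> S" "s' \<in> S" "f s +o W = f s' +o W"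
    interpret l: Vector_Spaces.linear scl "(*)" "\<phi> s" by (rule lin[OF *(1)])
    have "\<phi> s (f s - f s') = 0" using * by (intro van) (simp_all add: coset_eq_iff)
    then show "s = s'" using * dual by (simp add: l.diff split: if_splits)
  qed
  have sub: "?c ` S \<subseteq> carrier (quotient_space scl V W)"
    using f by (auto simp: carrier_quotient_space)
  have lc: "Q.lincomb a (?c ` T) = (\<Sum>s\<in>T. scl (a (?c s)) (f s)) +o W" if "T \<subseteq> S" for a T
  proof -
    have "finite T" using that S finite_subset by blast
    then show ?thesis using that
    proof (induction T)
      case empty
      then show ?case by (simp add: Q.lincomb_def quotient_space_ops)
    next
      case (insert x T)
      have "?c x \<notin> ?c ` T" using insert inj by (auto simp: inj_on_def)
      moreover have "?c ` insert x T \<subseteq> carrier (quotient_space scl V W)" using insert sub by auto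
      ultimately have "Q.lincomb a (?c ` insert x T) =
          a (?c x) \<odot>\<^bsub>quotient_space scl V W\<^esub> ?c x \<oplus>\<^bsub>quotient_space scl V W\<^esub> Q.lincomb a (?c ` T)"
        using insert unfolding Q.lincomb_def
        by (simp only: image_insert) (subst Q.finsum_insert, auto simp: Pi_def)
      then show ?case using insert by (simp add: quotient_space_ops)
    qed
  qed
  have "Q.lin_indpt (?c ` S)"
  proof
    assume "Q.lin_dep (?c ` S)"
    then obtain A a v where A: "A \<subseteq> ?c ` S" "Q.lincomb a A = W" "v \<in> A" "a v \<noteq> 0"
      unfolding Q.lin_dep_def by (auto simp: quotient_space_ops)
    then obtain T where T: "T \<subseteq> S" "A = ?c ` T" by (meson subset_imageE)
    then obtain t where t: "t \<in> T" "v = ?c t" using A by auto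
    interpret l: Vector_Spaces.linear scl "(*)" "\<phi> t" using lin t T by auto
    have "(\<Sum>s\<in>T. scl (a (?c s)) (f s)) +o W = 0 +o W" using lc[OF T(1)] A T by simp
    then have "(\<Sum>s\<in>T. scl (a (?c s)) (f s)) \<in> W" by (simp only: coset_eq_iff) simp
    \<comment> \<open>Applying the dual functional \<open>\<phi> t\<close> to the relation isolates
      the coefficient of \<open>v\<close>.\<close>
    then have "\<phi> t (\<Sum>s\<in>T. scl (a (?c s)) (f s)) = 0" using van t T by auto
    then have "(\<Sum>s\<in>T. a (?c s) * \<phi> t (f s)) = 0" by (simp add: l.sum l.scale)
    also have "(\<Sum>s\<in>T. a (?c s) * \<phi> t (f s)) = (\<Sum>s\<in>T. if s = t then a (?c s) else 0)"
      using t T by (intro sum.cong) (auto simp: dual subset_iff)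
    also have "\<dots> = a v" using t T S by (simp add: sum.delta finite_subset)
    finally show False using A by simp
  qed
  from Q.li_le_dim(2)[OF fd sub this] show ?thesis by (simp add: card_image[OF inj])
qed

end

text \<open>Each functional cuts out a subspace of codimension at most one, so induction over
  \<open>S\<close> costs one spanning vector per functional. \<open>V\<close> varies because the
  induction hypothesis is applied to a kernel inside it.\<close>

lemma spanning_by_functionals:
  fixes scl :: "'a::field \<Rightarrow> 'v::ab_group_add \<Rightarrow> 'v"
  assumes vs: "vector_space scl" and S: "finite S"
    and V: "Modules.module.subspace scl V"
    and lin: "\<And>s. s \<in> S \<Longrightarrow> Vector_Spaces.linear scl (*) (\<phi> s)"
    and ker: "\<And>v. v \<in> V \<Longrightarrow> (\<And>s. s \<in> S \<Longrightarrow> \<phi> s v = (0 :: 'a)) \<Longrightarrow> v \<in> W"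
  shows "\<exists>B. finite B \<and> B \<subseteq> V \<and> card B \<le> card S \<and> V \<subseteq> Modules.module.span scl (B \<union> W)"
  using S V lin ker
proof (induction S arbitrary: V)
  case empty
  interpret vector_space scl by (rule vs)
  have "V \<subseteq> span W" using empty span_superset by blast
  then show ?case by (intro exI[of _ "{}"]) auto
next
  case (insert s S)
  interpret vector_space scl by (rule vs)
  interpret l: Vector_Spaces.linear scl "(*)" "\<phi> s" using insert by auto
  let ?V = "{v \<in> V. \<phi> s v = 0}"
  have sub: "subspace ?V" using insert(4) by (auto simp: subspace_def l.add l.scale)
  have "\<exists>B. finite B \<and> B \<subseteq> ?V \<and> card B \<le> card S \<and> ?V \<subseteq> span (B \<union> W)"
    by (rule insert.IH[OF sub]) (use insert.prems in blast)+
  then obtain B where B: "finite B" "B \<subseteq> ?V" "card B \<le> card S" "?V \<subseteq> span (B \<union> W)"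
    by blast
  show ?case
  proof (cases "V \<subseteq> ?V")
    case True
    then have "V \<subseteq> span (B \<union> W)" "B \<subseteq> V" using B by blast+
    moreover have "card B \<le> card (insert s S)" using B(3) insert(1,2) by simp
    ultimately show ?thesis using B(1) by blast
  next
    case False
    then obtain b where b: "b \<in> V" "\<phi> s b \<noteq> 0" by auto
    have "v \<in> span (insert b B \<union> W)" if "v \<in> V" for v
    proof -
      \<comment> \<open>The multiple of \<open>b\<close> on which \<open>\<phi> s\<close> takes the
        same value as on \<open>v\<close>; subtracting it lands in the kernel.\<close>
      let ?c = "scl (\<phi> s v / \<phi> s b) b"
      have "v - ?c \<in> ?V"
        using that b insert(4) by (simp add: subspace_diff subspace_scale l.diff l.scale)
      then have "v - ?c \<in> span (B \<union> W)" using B by auto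
      then have "v - ?c \<in> span (insert b B \<union> W)" using span_mono[of "B \<union> W" "insert b B \<union> W"] by auto
      moreover have "?c \<in> span (insert b B \<union> W)" by (intro span_scale span_base) auto
      ultimately show ?thesis using span_add by fastforce
    qed
    moreover have "card (insert b B) \<le> card (insert s S)"
      using B(1,3) insert(1,2) by (simp add: card_insert_if)
    moreover have "insert b B \<subseteq> V" "finite (insert b B)" using B b by auto
    ultimately show ?thesis by blast
  qed
qed

text \<open>Finite dimension is recorded along with the bound, since the lower bound relies on
  it.\<close>

lemma dim_quotient_space_le:
  fixes scl :: "'a::field \<Rightarrow> 'v::ab_group_add \<Rightarrow> 'v"
  assumes vs: "vector_space scl" and S: "finite S"
    and V: "Modules.module.subspace scl V" and W: "Modules.module.subspace scl W"
    and lin: "\<And>s. s \<in> S \<Longrightarrow> Vector_Spaces.linear scl (*) (\<phi> s)"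
    and ker: "\<And>v. v \<in> V \<Longrightarrow> (\<And>s. s \<in> S \<Longrightarrow> \<phi> s v = (0 :: 'a)) \<Longrightarrow> v \<in> W"
  shows "vectorspace.fin_dim class_ring (quotient_space scl V W)"
    and "vectorspace.dim class_ring (quotient_space scl V W) \<le> card S"
proof -
  obtain B where B: "finite B" "B \<subseteq> V" "card B \<le> card S" "V \<subseteq> Modules.module.span scl (B \<union> W)"
    using spanning_by_functionals[where \<phi> = \<phi> and W = W, OF vs S V lin ker] by metis
  show "vectorspace.fin_dim class_ring (quotient_space scl V W)"
    by (rule dim_quotient_space_le_spanning(1)[OF vs V W B(1,2,4)])
  show "vectorspace.dim class_ring (quotient_space scl V W) \<le> card S"
    using dim_quotient_space_le_spanning(2)[OF vs V W B(1,2,4)] B(3) by linarith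
qed

section \<open>Multilinear polynomials and their values\<close>

text \<open>The linear extension of \<open>g\<close> from words to polynomials. Every matrix entry
  of an evaluation has this form, so identities become joint kernels of such functionals.\<close>

definition word_functional :: "(('t \<times> nat) list \<Rightarrow> 'a) \<Rightarrow> ('t, 'a::field) gr_poly \<Rightarrow> 'a" where
  "word_functional g f = (\<Sum>w\<in>Poly_Mapping.keys f. Poly_Mapping.lookup f w * g w)"

lemma lookup_poly_scale [simp]:
  "Poly_Mapping.lookup (poly_scale c f) w = c * Poly_Mapping.lookup f w"
  by (simp add: poly_scale_def Poly_Mapping.map.rep_eq when_def)

lemma word_functional_superset:
  assumes "finite K" "Poly_Mapping.keys f \<subseteq> K"
  shows "word_functional g f = (\<Sum>w\<in>K. Poly_Mapping.lookup f w * g w)"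
  unfolding word_functional_def using assms
  by (intro sum.mono_neutral_left) (auto simp: in_keys_iff)

lemma linear_word_functional:
  fixes g :: "('t \<times> nat) list \<Rightarrow> 'b::field"
  shows "Vector_Spaces.linear poly_scale (*) (word_functional g)"
proof -
  have "vector_space ((*) :: 'b \<Rightarrow> _)" by standard (auto simp: algebra_simps)
  moreover have "word_functional g (f + f') = word_functional g f + word_functional g f'" for f f'
  proof -
    let ?K = "Poly_Mapping.keys f \<union> Poly_Mapping.keys f'"
    have "finite ?K" by simp
    note * = word_functional_superset[OF this]
    have "Poly_Mapping.keys (f + f') \<subseteq> ?K" by (rule Poly_Mapping.keys_add)
    then show ?thesis
      by (simp add: *[of f] *[of f'] * lookup_add sum.distrib algebra_simps)
  qed
  moreover have "word_functional g (poly_scale c f) = c * word_functional g f" for c f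
  proof -
    have "Poly_Mapping.keys (poly_scale c f) \<subseteq> Poly_Mapping.keys f"
      by (auto simp: in_keys_iff)
    then show ?thesis
      by (subst word_functional_superset[of "Poly_Mapping.keys f"])
        (simp_all add: word_functional_def sum_distrib_left mult.assoc)
  qed
  ultimately show ?thesis
    unfolding Vector_Spaces.linear_def Modules.module_hom_def Modules.module_hom_axioms_def module_iff_vector_space
    using vector_space_poly_scale by blast
qed

lemma word_functional_single [simp]: "word_functional g (Poly_Mapping.single w c) = c * g w"
  by (simp add: word_functional_def)

lemma word_functional_cong:
  assumes "\<And>w. w \<in> Poly_Mapping.keys f \<Longrightarrow> g w = h w"
  shows "word_functional g f = word_functional h f"
  unfolding word_functional_def using assms by (intro sum.cong) auto

definition multilinear_words :: "nat \<Rightarrow> ('t \<times> nat) list set" where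
  "multilinear_words n = {w. distinct (map snd w) \<and> set (map snd w) = {1..n}}"

text \<open>Degrees and permutation can be read off a word position by position, which replaces the
  parametrisation by \<open>t\<close> and \<open>\<sigma>\<close> with a condition on words.\<close>

lemma graded_multilinear_eq_span:
  "(graded_multilinear n :: ('t, 'a) gr_poly set) =
    Modules.module.span poly_scale ((\<lambda>w. Poly_Mapping.single w (1::'a::field)) ` multilinear_words n)"
proof -
  have "{map (\<lambda>j. (t j, \<sigma> j)) [1..<Suc n] | (t :: nat \<Rightarrow> 't) \<sigma>. \<sigma> permutes {1..n}}
      = multilinear_words n" (is "?L = _")
  proof (intro equalityI subsetI)
    fix w assume "w \<in> ?L"
    then obtain t :: "nat \<Rightarrow> 't" and \<sigma> where w: "w = map (\<lambda>j. (t j, \<sigma> j)) [1..<Suc n]"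
      and \<sigma>: "\<sigma> permutes {1..n}" by auto
    have "map snd w = map \<sigma> [1..<Suc n]" by (simp add: w)
    moreover have "set [1..<Suc n] = {1..n}" by auto
    moreover have "distinct [1..<Suc n]" by (rule distinct_upt)
    ultimately show "w \<in> multilinear_words n"
      using permutes_inj_on[OF \<sigma>, of "{1..n}"] permutes_image[OF \<sigma>]
      unfolding multilinear_words_def mem_Collect_eq by (simp only: distinct_map set_map)
  next
    fix w :: "('t \<times> nat) list" assume "w \<in> multilinear_words n"
    then have d: "distinct (map snd w)" and s: "set (map snd w) = {1..n}"
      by (auto simp: multilinear_words_def)
    have len: "length w = n" using distinct_card[OF d] s by simp
    \<comment> \<open>Indices start at 1 but list positions at 0, hence the shift.\<close>
    define \<sigma> where "\<sigma> j = (if j \<in> {1..n} then map snd w ! (j - 1) else j)" for j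
    have "bij_betw (\<lambda>j. j - 1) {1..n} {..<n}"
      by (rule bij_betwI[where g = Suc]) auto
    moreover have "bij_betw ((!) (map snd w)) {..<n} {1..n}"
      using bij_betw_nth[OF d] len s by simp
    ultimately have "bij_betw ((!) (map snd w) \<circ> (\<lambda>j. j - 1)) {1..n} {1..n}"
      by (rule bij_betw_trans)
    then have "bij_betw \<sigma> {1..n} {1..n}"
      by (subst bij_betw_cong[where g = "(!) (map snd w) \<circ> (\<lambda>j. j - 1)"]) (auto simp: \<sigma>_def)
    then have "\<sigma> permutes {1..n}"
      by (rule bij_imp_permutes) (auto simp: \<sigma>_def)
    moreover have "w = map (\<lambda>j. (fst (w ! (j - 1)), \<sigma> j)) [1..<Suc n]"
      by (rule nth_equalityI) (auto simp: len \<sigma>_def simp del: upt_Suc)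
    ultimately show "w \<in> ?L"
      by (intro CollectI exI[of _ "\<lambda>j. fst (w ! (j - 1))"] exI[of _ \<sigma>]) simp
  qed
  from this[symmetric] have "{Poly_Mapping.single (map (\<lambda>j. (t j, \<sigma> j)) [1..<Suc n]) (1::'a) |
      (t :: nat \<Rightarrow> 't) \<sigma>. \<sigma> permutes {1..n}} = (\<lambda>w. Poly_Mapping.single w 1) ` multilinear_words n"
    by (simp only:) blast
  then show ?thesis by (simp only: graded_multilinear_def)
qed

lemma keys_graded_multilinear:
  assumes "f \<in> graded_multilinear n"
  shows "Poly_Mapping.keys f \<subseteq> multilinear_words n"
proof -
  interpret vector_space poly_scale by (rule vector_space_poly_scale)
  from assms show ?thesis unfolding graded_multilinear_eq_span
  proof (induction rule: span_induct_alt)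
    case base
    show ?case by simp
  next
    case (step c x y)
    then have "Poly_Mapping.keys (poly_scale c x) \<subseteq> multilinear_words n"
      by (auto simp: in_keys_iff lookup_single when_def split: if_splits)
    then show ?case using step Poly_Mapping.keys_add[of "poly_scale c x" y] by blast
  qed
qed

text \<open>In contrast to \<open>eval_word\<close>, the empty word has the identity matrix as its
  value, which makes evaluation multiplicative under concatenation.\<close>

definition word_matrix :: "('x \<Rightarrow> 'a::field ^ 2 ^ 2) \<Rightarrow> 'x list \<Rightarrow> 'a ^ 2 ^ 2" where
  "word_matrix m w = foldr (\<lambda>x. (**) (m x)) w (Finite_Cartesian_Product.mat 1)"

lemma word_matrix_simps [simp]:
  "word_matrix m [] = Finite_Cartesian_Product.mat 1"
  "word_matrix m (x # w) = m x ** word_matrix m w"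
  by (simp_all add: word_matrix_def)

lemma word_matrix_append: "word_matrix m (u @ v) = word_matrix m u ** word_matrix m v"
  by (induction u) (simp_all add: matrix_mul_assoc)

lemma word_matrix_cong:
  assumes "\<And>x. x \<in> set w \<Longrightarrow> m x = m' x"
  shows "word_matrix m w = word_matrix m' w"
  using assms by (induction w) auto

lemma word_matrix_eq_0: "x \<in> set w \<Longrightarrow> m x = 0 \<Longrightarrow> word_matrix m w = 0"
  by (induction w) auto

lemma eval_word_pair_mult:
  assumes "w \<noteq> []"
  shows "eval_word pair_mult e w = (word_matrix (fst \<circ> e) w, word_matrix (snd \<circ> e) w)"
  using assms
proof (induction w rule: induct_list012)
  case (3 x y w)
  then show ?case by (simp add: pair_mult_def)
qed simp_all

text \<open>
  The second component of a substitution is again an admissible first component, with the degree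
  \<open>0\<close> variables sent to \<open>0\<close>; hence only first components matter.
\<close>

lemma graded_identity_iff:
  fixes f :: "(bit, 'a::field) gr_poly"
  assumes f: "f \<in> graded_multilinear n" and n: "n \<ge> 1"
  shows "f \<in> graded_identities pair_scale pair_mult T1_gr \<longleftrightarrow>
    (\<forall>m p q. (\<forall>i. m (1, i) $ 2 $ 1 = 0) \<longrightarrow> word_functional (\<lambda>w. word_matrix m w $ p $ q) f = 0)"
    (is "?I \<longleftrightarrow> ?R")
proof -
  note keys = keys_graded_multilinear[OF f]
  have ne: "w \<noteq> []" if "w \<in> Poly_Mapping.keys f" for w
    using that keys n by (auto simp: multilinear_words_def)
  then have free: "f \<in> free_algebra" by (auto simp: free_algebra_def in_keys_iff)
  have ev: "fst (eval_poly pair_scale pair_mult e f) $ p $ q =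
        word_functional (\<lambda>w. word_matrix (fst \<circ> e) w $ p $ q) f"
      "snd (eval_poly pair_scale pair_mult e f) $ p $ q =
        word_functional (\<lambda>w. word_matrix (snd \<circ> e) w $ p $ q) f" for e p q
    unfolding eval_poly_def word_functional_def fst_sum snd_sum sum_component
    by (auto intro!: sum.cong simp: ne pair_scale_def eval_word_pair_mult map_matrix_def)
  show ?thesis
  proof
    assume I: ?I
    show ?R
    proof (intro allI impI)
      fix m :: "bit \<times> nat \<Rightarrow> 'a ^ 2 ^ 2" and p q assume m: "\<forall>i. m (1, i) $ 2 $ 1 = 0"
      \<comment> \<open>The homogeneous substitution with first component \<open>m\<close>: degree 0
        forces a zero second component, degree 1 an equal one.\<close>
      define e where "e x = (m x, if fst x = 0 then 0 else m x)" for x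
      have "e (t, i) \<in> T1_gr t" for t i using m by (cases t) (auto simp: e_def T1_gr_def UT2_def)
      then have "eval_poly pair_scale pair_mult e f = 0"
        using I by (auto simp: graded_identities_def)
      then have "fst (eval_poly pair_scale pair_mult e f) $ p $ q = 0" by simp
      then show "word_functional (\<lambda>w. word_matrix m w $ p $ q) f = 0"
        by (simp add: ev comp_def e_def)
    qed
  next
    assume R: ?R
    have "eval_poly pair_scale pair_mult e f = 0" if e: "\<forall>t i. e (t, i) \<in> T1_gr t" for e
    proof -
      have "fst (e (1, i)) $ 2 $ 1 = 0" "snd (e (1, i)) $ 2 $ 1 = 0" for i
        using e[rule_format, of 1 i] by (auto simp: T1_gr_def UT2_def)
      then have "fst (eval_poly pair_scale pair_mult e f) $ p $ q = 0"
          "snd (eval_poly pair_scale pair_mult e f) $ p $ q = 0" for p q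
        using R unfolding ev by (simp_all add: comp_def)
      then show ?thesis by (auto simp: prod_eq_iff Finite_Cartesian_Product.vec_eq_iff)
    qed
    then show ?I using free by (auto simp: graded_identities_def)
  qed
qed

lemma subspace_graded_multilinear: "Modules.module.subspace poly_scale (graded_multilinear n)"
proof -
  interpret vector_space poly_scale by (rule vector_space_poly_scale)
  show ?thesis unfolding graded_multilinear_def by (rule subspace_span)
qed

lemma subspace_multilinear_identities:
  assumes "n \<ge> 1"
  shows "Modules.module.subspace poly_scale
    (graded_multilinear n \<inter> graded_identities pair_scale pair_mult (T1_gr :: bit \<Rightarrow> (('a::field ^ 2 ^ 2) \<times> _) set))"
proof -
  interpret vector_space "poly_scale :: 'a \<Rightarrow> (bit, 'a) gr_poly \<Rightarrow> _"
    by (rule vector_space_poly_scale)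
  have "subspace {f. word_functional g f = 0}" for g :: "(bit \<times> nat) list \<Rightarrow> 'a"
  proof -
    interpret l: Vector_Spaces.linear poly_scale "(*)" "word_functional g"
      by (rule linear_word_functional)
    show ?thesis by (auto simp: subspace_def l.add l.scale)
  qed
  then have "subspace (graded_multilinear n \<inter>
     (\<Inter>x\<in>{(m, p, q) | m p q. \<forall>i. m (1, i) $ 2 $ 1 = 0}.
        case x of (m, p, q) \<Rightarrow> {f. word_functional (\<lambda>w. word_matrix m w $ p $ q) f = (0::'a)}))"
    by (intro subspace_inter subspace_graded_multilinear subspace_Inter) auto
  also have "(graded_multilinear n \<inter>
     (\<Inter>x\<in>{(m, p, q) | m p q. \<forall>i. m (1, i) $ 2 $ 1 = 0}.
        case x of (m, p, q) \<Rightarrow> {f. word_functional (\<lambda>w. word_matrix m w $ p $ q) f = (0::'a)})) =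
     graded_multilinear n \<inter> graded_identities pair_scale pair_mult T1_gr"
    using graded_identity_iff[OF _ assms] by auto
  finally show ?thesis .
qed

section \<open>The upper bound\<close>

text \<open>
  A letter \<open>(t, r, c)\<close> stands for a variable of degree \<open>t\<close> evaluated at the matrix unit with its
  entry in row \<open>r\<close> and column \<open>c\<close>.
\<close>

type_synonym letter = "bit \<times> 2 \<times> 2"

definition letters :: "letter set" where
  "letters = {(t, r, c). \<not> (t = 1 \<and> r = 2 \<and> c = 1)}"

definition matrix_unit :: "2 \<Rightarrow> 2 \<Rightarrow> 'a::field ^ 2 ^ 2" where
  "matrix_unit r c = (\<chi> i j. of_bool (i = r \<and> j = c))"

text \<open>At each index only the variable of the degree named by the letter is nonzero, so
  \<open>a\<close> also selects the degrees of the words that survive.\<close>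

definition unit_subst :: "(nat \<Rightarrow> letter) \<Rightarrow> bit \<times> nat \<Rightarrow> 'a::field ^ 2 ^ 2" where
  "unit_subst a = (\<lambda>(t, i). case a i of (t', r, c) \<Rightarrow> if t = t' then matrix_unit r c else 0)"

text \<open>The degree of a matrix unit in the natural integer grading of the matrix algebra:
  \<open>1\<close> for e_12, \<open>-1\<close> for e_21, \<open>0\<close> on the diagonal.\<close>

definition weight :: "letter \<Rightarrow> int" where
  "weight = (\<lambda>(t, r, c). of_bool (c = 2) - of_bool (r = 2))"

lemma letters_eq:
  "letters = {(0, 1, 1), (0, 1, 2), (0, 2, 1), (0, 2, 2), (1, 1, 1), (1, 1, 2), (1, 2, 2)}"
proof -
  have "l \<in> letters \<longleftrightarrow> l \<in> {(0, 1, 1), (0, 1, 2), (0, 2, 1), (0, 2, 2), (1, 1, 1), (1, 1, 2), (1, 2, 2)}"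
    for l
  proof (cases l)
    case (fields t r c)
    have "t = 0 \<or> t = 1" by (cases t) auto
    then show ?thesis using exhaust_2[of r] exhaust_2[of c] by (auto simp: fields letters_def)
  qed
  then show ?thesis by blast
qed

lemma sum_letters: "(\<Sum>l\<in>letters. g l) = g (0, 1, 1) + g (0, 1, 2) + g (0, 2, 1) + g (0, 2, 2) +
    g (1, 1, 1) + g (1, 1, 2) + g (1, 2, 2)"
  for g :: "letter \<Rightarrow> 'a::comm_monoid_add"
  by (simp add: letters_eq add.assoc)

lemma finite_letters: "finite letters" by (simp add: letters_eq)

lemma matrix_unit_nth [simp]: "matrix_unit r c $ i $ j = of_bool (i = r \<and> j = c)"
  by (simp add: matrix_unit_def)

lemma matrix_mult_entry_2:
  fixes A B :: "'a::field ^ 2 ^ 2"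
  shows "(A ** B) $ i $ j = A $ i $ 1 * B $ 1 $ j + A $ i $ 2 * B $ 2 $ j"
  by (simp add: matrix_matrix_mult_def sum_2)

lemma matrix_sandwich_entry:
  fixes A M B :: "'a::field ^ 2 ^ 2"
  shows "(A ** (M ** B)) $ p $ q =
    A $ p $ 1 * M $ 1 $ 1 * B $ 1 $ q + A $ p $ 1 * M $ 1 $ 2 * B $ 2 $ q +
    A $ p $ 2 * M $ 2 $ 1 * B $ 1 $ q + A $ p $ 2 * M $ 2 $ 2 * B $ 2 $ q"
  unfolding matrix_mult_entry_2 by (simp only: distrib_left mult.assoc add.assoc)

text \<open>In the integer grading by \<open>weight\<close> degrees add under multiplication, and an
  entry at \<open>(p, q)\<close> lives in a single degree.\<close>

lemma word_matrix_homogeneous: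
  assumes "\<And>x r c. x \<in> set w \<Longrightarrow> m x $ r $ c \<noteq> 0 \<Longrightarrow> of_bool (c = 2) - of_bool (r = 2) = d x"
    and "word_matrix m w $ p $ q \<noteq> 0"
  shows "of_bool (q = 2) - of_bool (p = 2) = (\<Sum>x\<leftarrow>w. d x :: int)"
  using assms
proof (induction w arbitrary: p)
  case Nil
  then show ?case by (simp add: Finite_Cartesian_Product.mat_def split: if_splits)
next
  case (Cons x w)
  from Cons.prems(2) obtain r where r: "m x $ p $ r \<noteq> 0" "word_matrix m w $ r $ q \<noteq> 0"
    by (cases "m x $ p $ 1 * word_matrix m w $ 1 $ q = 0") (auto simp: matrix_mult_entry_2)
  have "of_bool (q = 2) - of_bool (r = 2) = (\<Sum>x\<leftarrow>w. d x)"
    by (rule Cons.IH) (use Cons.prems r in auto)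
  moreover have "of_bool (r = 2) - of_bool (p = 2) = d x" using Cons.prems r by auto
  ultimately show ?case by simp
qed

text \<open>A multilinear word uses each index once, so its total weight is the same in every order
  of the factors. Zero values are homogeneous of any degree and cause no exception.\<close>

lemma word_matrix_unit_subst_weight:
  assumes w: "w \<in> multilinear_words n" and nz: "word_matrix (unit_subst a) w $ p $ q \<noteq> 0"
  shows "(\<Sum>i=1..n. weight (a i)) = of_bool (q = 2) - of_bool (p = 2)"
proof -
  have d: "distinct (map snd w)" and s: "set (map snd w) = {1..n}"
    using w by (auto simp: multilinear_words_def)
  have "of_bool (q = 2) - of_bool (p = 2) = (\<Sum>x\<leftarrow>w. weight (a (snd x)))"
    by (rule word_matrix_homogeneous[OF _ nz])
      (auto simp: unit_subst_def weight_def split: prod.splits if_splits)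
  also have "\<dots> = (\<Sum>i\<leftarrow>map snd w. weight (a i))" by (simp add: comp_def)
  also have "\<dots> = (\<Sum>i=1..n. weight (a i))"
    using sum_list_distinct_conv_sum_set[OF d, of "\<lambda>i. weight (a i)"] s by simp
  finally show ?thesis ..
qed

text \<open>A multilinear word is linear in the pair of values of the two variables with index \<open>i\<close>.\<close>

lemma word_matrix_expand:
  fixes m :: "bit \<times> nat \<Rightarrow> 'a::field ^ 2 ^ 2"
  assumes w: "w \<in> multilinear_words n" and i: "i \<in> {1..n}" and m: "m (1, i) $ 2 $ 1 = 0"
  shows "word_matrix m w $ p $ q = (\<Sum>l\<in>letters. m (fst l, i) $ fst (snd l) $ snd (snd l) *
     word_matrix (\<lambda>x. if snd x = i then unit_subst (\<lambda>_. l) x else m x) w $ p $ q)"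
proof -
  have "i \<in> set (map snd w)" using w i by (auto simp: multilinear_words_def)
  then obtain t where "(t, i) \<in> set w" by auto
  then obtain u v where uv: "w = u @ (t, i) # v" by (meson split_list)
  have u: "snd x \<noteq> i" if "x \<in> set u" for x
    using w uv that by (auto simp: multilinear_words_def)
  have v: "snd x \<noteq> i" if "x \<in> set v" for x
    using w uv that by (auto simp: multilinear_words_def)
  let ?m = "\<lambda>l x. if snd x = i then unit_subst (\<lambda>_. l) x else m x"
  have "word_matrix (?m l) u = word_matrix m u" "word_matrix (?m l) v = word_matrix m v" for l
    by (rule word_matrix_cong, use u v in simp)+
  then have *: "word_matrix (?m l) w =
      word_matrix m u ** (unit_subst (\<lambda>_. l) (t, i) ** word_matrix m v)" for l
    by (simp add: uv word_matrix_append)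
  define A B where "A = word_matrix m u" and "B = word_matrix m v"
  have t: "t = 0 \<or> t = 1" by (cases t) auto
  have "word_matrix m w = A ** (m (t, i) ** B)"
    by (simp add: uv word_matrix_append A_def B_def)
  moreover have "word_matrix (?m (t', r, c)) w $ p $ q = of_bool (t = t') * (A $ p $ r * B $ c $ q)"
    for t' r c
    unfolding * A_def[symmetric] B_def[symmetric] using exhaust_2[of r] exhaust_2[of c]
    by (auto simp: unit_subst_def matrix_sandwich_entry)
  \<comment> \<open>In degree 1 the unit missing from \<open>letters\<close> would carry the
    coefficient \<open>m (1, i) $ 2 $ 1\<close>, which is 0.\<close>
  ultimately show ?thesis using t m
    by (elim disjE) (simp_all add: sum_letters matrix_sandwich_entry mult_ac)
qed

lemma word_functional_sum:
  "word_functional (\<lambda>w. \<Sum>l\<in>L. c l * g l w) f = (\<Sum>l\<in>L. c l * word_functional (g l) f)"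
proof -
  have "word_functional (\<lambda>w. \<Sum>l\<in>L. c l * g l w) f =
      (\<Sum>w\<in>Poly_Mapping.keys f. \<Sum>l\<in>L. c l * (Poly_Mapping.lookup f w * g l w))"
    by (simp add: word_functional_def sum_distrib_left mult.left_commute)
  also have "\<dots> = (\<Sum>l\<in>L. \<Sum>w\<in>Poly_Mapping.keys f. c l * (Poly_Mapping.lookup f w * g l w))"
    by (rule sum.swap)
  finally show ?thesis by (simp add: word_functional_def sum_distrib_left)
qed

text \<open>By multilinearity the variables can be replaced one after the other by matrix
  units.\<close>

lemma word_functional_eq_0_by_units:
  fixes f :: "(bit, 'a::field) gr_poly"
  assumes f: "f \<in> graded_multilinear n"
    and units: "\<And>a. a \<in> {1..n} \<rightarrow>\<^sub>E letters \<Longrightarrow>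
      word_functional (\<lambda>w. word_matrix (unit_subst a) w $ p $ q) f = 0"
    and m: "\<And>i. m (1, i) $ 2 $ 1 = 0"
  shows "word_functional (\<lambda>w. word_matrix m w $ p $ q) f = 0"
proof -
  note keys = keys_graded_multilinear[OF f]
  \<comment> \<open>Induction on the number \<open>k\<close> of variables still arbitrary; those
    after \<open>k\<close> already take the units recorded in \<open>a\<close>.\<close>
  have "word_functional (\<lambda>w. word_matrix m w $ p $ q) f = 0"
    if "k \<le> n" "\<And>i. m (1, i) $ 2 $ 1 = 0" "a \<in> {1..n} \<rightarrow> letters"
      "\<And>t i. k < i \<Longrightarrow> i \<le> n \<Longrightarrow> m (t, i) = unit_subst a (t, i)" for k m a
    using that
  proof (induction k arbitrary: m a)
    case 0
    have "word_functional (\<lambda>w. word_matrix m w $ p $ q) f =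
        word_functional (\<lambda>w. word_matrix (unit_subst (restrict a {1..n})) w $ p $ q) f"
    proof (rule word_functional_cong)
      fix w assume "w \<in> Poly_Mapping.keys f"
      then have "set (map snd w) = {1..n}" using keys by (auto simp: multilinear_words_def)
      then have "word_matrix m w = word_matrix (unit_subst (restrict a {1..n})) w"
      proof (intro word_matrix_cong)
        fix x assume "x \<in> set w"
        then have "snd x \<in> {1..n}" using \<open>set (map snd w) = {1..n}\<close> by auto
        then show "m x = unit_subst (restrict a {1..n}) x"
          using 0(4)[of "snd x" "fst x"] by (simp add: unit_subst_def split_beta)
      qed
      then show "word_matrix m w $ p $ q =
          word_matrix (unit_subst (restrict a {1..n})) w $ p $ q" by simp
    qed
    also have "\<dots> = 0" using 0(3) by (intro units) auto
    finally show ?case .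
  next
    case (Suc k)
    let ?i = "Suc k"
    let ?m = "\<lambda>l x. if snd x = ?i then unit_subst (\<lambda>_. l) x else m x"
    have i: "?i \<in> {1..n}" using Suc.prems by auto
    have "word_functional (\<lambda>w. word_matrix m w $ p $ q) f = word_functional (\<lambda>w. \<Sum>l\<in>letters.
        m (fst l, ?i) $ fst (snd l) $ snd (snd l) * word_matrix (?m l) w $ p $ q) f"
      by (rule word_functional_cong, rule word_matrix_expand) (use keys i Suc.prems(2) in blast)+
    also have "\<dots> = (\<Sum>l\<in>letters. m (fst l, ?i) $ fst (snd l) $ snd (snd l) *
        word_functional (\<lambda>w. word_matrix (?m l) w $ p $ q) f)"
      by (rule word_functional_sum)
    also have "\<dots> = 0"
    proof (rule sum.neutral, rule ballI)
      fix l assume l: "l \<in> letters"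
      have "word_functional (\<lambda>w. word_matrix (?m l) w $ p $ q) f = 0"
      proof (rule Suc.IH[where a = "a(?i := l)"])
        show "?m l (1, i) $ 2 $ 1 = 0" for i
          using Suc.prems(2)[of i] l by (auto simp: unit_subst_def letters_def split: prod.splits)
        show "a(?i := l) \<in> {1..n} \<rightarrow> letters" using Suc.prems(3) l by auto
        show "?m l (t, i) = unit_subst (a(?i := l)) (t, i)" if "k < i" "i \<le> n" for t i
          using Suc.prems(4)[of i t] that by (auto simp: unit_subst_def)
      qed (use Suc.prems in simp)
      then show "m (fst l, ?i) $ fst (snd l) $ snd (snd l) *
          word_functional (\<lambda>w. word_matrix (?m l) w $ p $ q) f = 0" by simp
    qed
    finally show ?case .
  qed
  \<comment> \<open>For \<open>k = n\<close> no variable has been replaced yet, so any choice of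
    letters serves as \<open>a\<close>.\<close>
  moreover have "(\<lambda>_. (0, 1, 1)) \<in> {1..n} \<rightarrow> letters" by (simp add: letters_def)
  ultimately show ?thesis using m by (metis le_refl linorder_not_less)
qed

section \<open>Balanced evaluations and their number\<close>

definition balanced_words :: "nat \<Rightarrow> (nat \<Rightarrow> letter) set" where
  "balanced_words n = {a \<in> {1..n} \<rightarrow>\<^sub>E letters. \<bar>\<Sum>i=1..n. weight (a i)\<bar> \<le> 1}"

lemma finite_balanced_words: "finite (balanced_words n)"
  unfolding balanced_words_def by (rule finite_Collect_conjI) (simp add: finite_PiE finite_letters)

text \<open>Unit evaluations detect all identities, and unbalanced ones vanish by weight. The factor
  4 counts the entries \<open>(p, q)\<close>.\<close>

lemma graded_codim_le_card_balanced_words: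
  assumes n: "n \<ge> 1"
  shows "vectorspace.fin_dim class_ring (quotient_space (poly_scale :: 'a::field \<Rightarrow> _)
      (graded_multilinear n) (graded_multilinear n \<inter> graded_identities pair_scale pair_mult T1_gr))"
      (is ?fin)
    and "graded_codim (pair_scale :: 'a \<Rightarrow> _) pair_mult T1_gr n \<le> 4 * card (balanced_words n)"
      (is ?le)
proof -
  let ?S = "balanced_words n \<times> (UNIV :: (2 \<times> 2) set)"
  let ?\<phi> = "\<lambda>(a, p, q). word_functional (\<lambda>w. word_matrix (unit_subst a) w $ p $ q :: 'a)"
  have card: "card ?S = 4 * card (balanced_words n)"
    by (simp add: card_cartesian_product flip: UNIV_Times_UNIV)
  have S: "finite ?S" using finite_balanced_words by simp
  have lin: "Vector_Spaces.linear poly_scale (*) (?\<phi> s)" for s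
    by (cases s) (simp add: linear_word_functional)
  have ker: "f \<in> graded_multilinear n \<inter> graded_identities pair_scale pair_mult T1_gr"
    if f: "f \<in> graded_multilinear n" and 0: "\<And>s. s \<in> ?S \<Longrightarrow> ?\<phi> s f = 0" for f
  proof -
    have "word_functional (\<lambda>w. word_matrix m w $ p $ q) f = 0"
      if m: "\<And>i. m (1, i) $ 2 $ 1 = 0" for m p q
    proof (rule word_functional_eq_0_by_units[OF f])
      fix a assume a: "a \<in> {1..n} \<rightarrow>\<^sub>E letters"
      show "word_functional (\<lambda>w. word_matrix (unit_subst a) w $ p $ q) f = 0"
      proof (cases "a \<in> balanced_words n")
        case True
        then show ?thesis using 0[of "(a, p, q)"] by simp
      next
        case False
        have "word_matrix (unit_subst a) w $ p $ q = (0 :: 'a)" if "w \<in> Poly_Mapping.keys f" for w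
        proof (rule ccontr)
          assume "word_matrix (unit_subst a) w $ p $ q \<noteq> (0 :: 'a)"
          moreover have "w \<in> multilinear_words n" using that keys_graded_multilinear[OF f] by blast
          ultimately have "(\<Sum>i=1..n. weight (a i)) = of_bool (q = 2) - of_bool (p = 2)"
            by (intro word_matrix_unit_subst_weight)
          then have "\<bar>\<Sum>i=1..n. weight (a i)\<bar> \<le> 1" by (cases "q = 2"; cases "p = 2") simp_all
          then show False using False a by (simp add: balanced_words_def)
        qed
        then show ?thesis by (simp add: word_functional_def)
      qed
    qed (rule m)
    then show ?thesis using f graded_identity_iff[OF f n] by auto
  qed
  note * = dim_quotient_space_le[OF vector_space_poly_scale S subspace_graded_multilinear
      subspace_multilinear_identities[OF n] lin ker]
  show ?fin by (rule *(1))
  show ?le using *(2) unfolding graded_codim_def card .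
qed

text \<open>An exponential moment bound: give a letter of weight \<open>k\<close> the value x^k. The
  total over all words is (4 + 2x + 1/x)^n, smallest at x = 1/sqrt 2, while every balanced word has
  value at least 1/sqrt 2.\<close>

lemma card_balanced_words_le: "real (card (balanced_words n)) \<le> sqrt 2 * (4 + 2 * sqrt 2) ^ n"
proof -
  define u :: "letter \<Rightarrow> real" where "u l = sqrt 2 powi (- weight l)" for l
  have "u (0, 1, 2) = 1 / sqrt 2" "u (1, 1, 2) = 1 / sqrt 2" "u (0, 2, 1) = sqrt 2"
    "u (0, 1, 1) = 1" "u (0, 2, 2) = 1" "u (1, 1, 1) = 1" "u (1, 2, 2) = 1"
    by (simp_all add: u_def weight_def power_int_minus field_simps)
  moreover have "1 / sqrt 2 + 1 / sqrt 2 = sqrt 2" by (simp add: field_simps)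
  ultimately have sum_u: "(\<Sum>l\<in>letters. u l) = 4 + 2 * sqrt 2"
    by (simp add: letters_eq)
  have prod_u: "(\<Prod>i=1..n. u (a i)) = sqrt 2 powi (- (\<Sum>i=1..n. weight (a i)))" for a
  proof (induction n)
    case (Suc n)
    then show ?case by (simp add: u_def power_int_add[symmetric])
  qed simp
  \<comment> \<open>Total weight at most 1 keeps the exponent of \<open>sqrt 2\<close> at least
    \<open>-1\<close>.\<close>
  have "1 / sqrt 2 \<le> (\<Prod>i=1..n. u (a i))" if "a \<in> balanced_words n" for a
  proof -
    have "-1 \<le> - (\<Sum>i=1..n. weight (a i))" using that by (auto simp: balanced_words_def)
    then have "sqrt 2 powi (-1) \<le> sqrt 2 powi (- (\<Sum>i=1..n. weight (a i)))"
      by (intro power_int_increasing) auto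
    then show ?thesis by (simp only: prod_u) (simp add: power_int_minus field_simps)
  qed
  then have "(\<Sum>a\<in>balanced_words n. 1 / sqrt 2) \<le> (\<Sum>a\<in>balanced_words n. \<Prod>i=1..n. u (a i))"
    by (rule sum_mono)
  also have "\<dots> \<le> (\<Sum>a\<in>{1..n} \<rightarrow>\<^sub>E letters. \<Prod>i=1..n. u (a i))"
    by (rule sum_mono2)
      (auto simp: balanced_words_def finite_PiE finite_letters u_def intro!: prod_nonneg zero_le_power_int)
  also have "\<dots> = (\<Prod>i=1..n. \<Sum>l\<in>letters. u l)"
    by (rule prod_sum_PiE[symmetric]) (simp_all add: finite_letters)
  also have "\<dots> = (4 + 2 * sqrt 2) ^ n" by (simp add: sum_u)
  finally show ?thesis by (simp add: field_simps)
qed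

section \<open>Products of traces as values of polynomials\<close>

lemma trace_2: "trace A = A $ 1 $ 1 + A $ 2 $ 2"
  for A :: "'a::semiring_1 ^ 2 ^ 2"
  by (simp add: trace_def sum_2)

text \<open>Matrix units compose like edges of a path: each column must equal the next row.\<close>

lemma word_matrix_units_entry:
  "word_matrix (\<lambda>i. matrix_unit (r i) (c i)) (x # w) $ p $ q =
    (of_bool (successively (\<lambda>i j. c i = r j) (x # w) \<and> p = r x \<and> q = c (last (x # w))) :: 'a::field)"
proof (induction w arbitrary: x p)
  case Nil
  show ?case by (simp add: matrix_mul_rid)
next
  case (Cons y w)
  have "word_matrix (\<lambda>i. matrix_unit (r i) (c i)) (x # y # w) $ p $ q =
     (\<Sum>k\<in>UNIV. of_bool (p = r x \<and> k = c x) *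
        (word_matrix (\<lambda>i. matrix_unit (r i) (c i)) (y # w) $ k $ q :: 'a))"
    by (subst word_matrix_simps) (simp only: matrix_matrix_mult_def vec_lambda_beta matrix_unit_nth)
  also have "\<dots> = (\<Sum>k\<in>UNIV. if k = c x then of_bool (p = r x) *
        (word_matrix (\<lambda>i. matrix_unit (r i) (c i)) (y # w) $ k $ q :: 'a) else 0)"
    by (rule sum.cong) auto
  also have "\<dots> = of_bool (p = r x) * word_matrix (\<lambda>i. matrix_unit (r i) (c i)) (y # w) $ c x $ q"
    by (simp only: sum.delta finite UNIV_I if_True)
  finally show ?case unfolding Cons.IH by auto
qed

lemma list_all2_snoc_iff_successively:
  "list_all2 P (x # w) (w @ [y]) \<longleftrightarrow> successively P (x # w @ [y])"
  by (induction w arbitrary: x) auto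

text \<open>The trace closes the path: the last column must also meet the first row, which turns the
  conditions on neighbours into one for the whole cycle.\<close>

lemma trace_cycle:
  fixes r c :: "'x \<Rightarrow> 2"
  assumes cs: "distinct cs" "cs \<noteq> []"
  shows "trace (word_matrix (\<lambda>i. matrix_unit (r i) (c i)) cs) =
    (of_bool (\<forall>j\<in>set cs. c j = r (cycle_of_list cs j)) :: 'a::field)"
proof -
  obtain x w where xw: "cs = x # w" using cs by (cases cs) auto
  \<comment> \<open>Rotating the list by one place lists the successors in the cycle.\<close>
  have rot: "w @ [x] = map (cycle_of_list cs) cs"
    using cyclic_rotation[OF cs(1), of 1] by (simp add: xw)
  have "(\<forall>j\<in>set cs. c j = r (cycle_of_list cs j)) \<longleftrightarrow>
      list_all2 (\<lambda>i j. c i = r j) (x # w) (w @ [x])"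
    unfolding rot xw[symmetric] by (simp add: list.rel_map(2) list_all2_same)
  also have "\<dots> \<longleftrightarrow> successively (\<lambda>i j. c i = r j) (x # w) \<and> c (last (x # w)) = r x"
    unfolding list_all2_snoc_iff_successively
    using successively_append_iff[of "\<lambda>i j. c i = r j" "x # w" "[x]"] by simp
  finally show ?thesis
    unfolding xw trace_2 word_matrix_units_entry using exhaust_2[of "r x"] by auto
qed

text \<open>Words whose product of traces detects \<open>\<sigma>\<close>; cycles of
  \<open>\<sigma>\<close> are the model. The \<open>itself\<close> argument fixes the field, which
  the other arguments leave open.\<close>

definition permutation_words :: "('x \<Rightarrow> 'x) \<Rightarrow> 'x set \<Rightarrow> 'x list list \<Rightarrow> 'a::field itself \<Rightarrow> bool" where
  "permutation_words \<sigma> S ws _ \<longleftrightarrow> distinct (concat ws) \<and> set (concat ws) = S \<and>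
     (\<forall>r c. (\<Prod>w\<leftarrow>ws. trace (word_matrix (\<lambda>i. matrix_unit (r i) (c i)) w)) =
        (of_bool (\<forall>j\<in>S. c j = r (\<sigma> j)) :: 'a))"

text \<open>Take the cycles themselves as words, fixed points being cycles of length one. Disjoint
  cycles act independently, so their conditions combine into a product of traces.\<close>

lemma cycle_decomp_permutation_words:
  assumes "cycle_decomp S \<sigma>"
  shows "\<sigma> permutes S \<and> (\<exists>ws. permutation_words \<sigma> S ws TYPE('a::field))"
  using assms
proof (induction rule: cycle_decomp.induct)
  case empty
  have "permutation_words id {} [] TYPE('a)" by (simp add: permutation_words_def)
  then show ?case using permutes_id by blast
next
  case (comp I p cs)
  from comp.IH obtain ws where p: "p permutes I" and ws: "permutation_words p I ws TYPE('a)"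
    by auto
  have perm: "cycle_of_list cs \<circ> p permutes set cs \<union> I"
    by (rule permutes_compose[OF permutes_subset[OF p] permutes_subset[OF cycle_permutes]]) auto
  show ?case
  proof (cases "cs = []")
    \<comment> \<open>An empty cycle must not contribute a word: the trace of the identity matrix is
      2, not 1.\<close>
    case True
    then show ?thesis using ws perm by (auto simp: comp_def)
  next
    case False
    have 1: "(cycle_of_list cs \<circ> p) j = cycle_of_list cs j" if "j \<in> set cs" for j
      using that comp.hyps p by (simp add: permutes_not_in disjoint_iff)
    have 2: "(cycle_of_list cs \<circ> p) j = p j" if "j \<in> I" for j
    proof -
      have "p j \<in> I" using permutes_in_image[OF p] that by simp
      then have "p j \<notin> set cs" using comp.hyps by auto
      then show ?thesis by (simp add: id_outside_supp)
    qed
    have "permutation_words (cycle_of_list cs \<circ> p) (set cs \<union> I) (cs # ws) TYPE('a)"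
      using ws comp.hyps unfolding permutation_words_def
      by (auto simp: trace_cycle False ball_Un 1 2 simp del: comp_apply)
    then show ?thesis using perm by blast
  qed
qed

section \<open>Polynomials whose values are products of traces\<close>

fun splits :: "'x list list \<Rightarrow> ('x list \<times> 'x list) list" where
  "splits [] = [([], [])]"
| "splits (w # ws) =
    map (\<lambda>(u, v). (w @ u, v)) (splits ws) @ map (\<lambda>(u, v). (u, w @ v)) (splits ws)"

lemma mset_splits: "(u, v) \<in> set (splits ws) \<Longrightarrow> mset u + mset v = mset (concat ws)"
  by (induction ws arbitrary: u v) auto

text \<open>
  \<open>\<delta>(A, B) = det (A e\<^sub>1, B e\<^sub>2)\<close> satisfies \<open>\<delta>(TA, B) + \<delta>(A, TB) = tr(T) \<delta>(A, B)\<close>, so that summing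
  over all ways of distributing the words over the two arguments produces the product of
  their traces.
\<close>

lemma sum_splits_eq_prod_trace:
  fixes m :: "'x \<Rightarrow> 'a::field ^ 2 ^ 2"
  shows "(\<Sum>(u, v)\<leftarrow>splits ws. word_matrix m u $ 1 $ 1 * word_matrix m v $ 2 $ 2 -
      word_matrix m u $ 2 $ 1 * word_matrix m v $ 1 $ 2) = (\<Prod>w\<leftarrow>ws. trace (word_matrix m w))"
proof (induction ws)
  case Nil
  show ?case by (simp add: Finite_Cartesian_Product.mat_def)
next
  case (Cons w ws)
  define d where "d u v = word_matrix m u $ 1 $ 1 * word_matrix m v $ 2 $ 2 -
      word_matrix m u $ 2 $ 1 * word_matrix m v $ 1 $ 2" for u v
  have d: "d (w @ u) v + d u (w @ v) = trace (word_matrix m w) * d u v" for u v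
    by (simp add: d_def word_matrix_append matrix_mult_entry_2 trace_2 algebra_simps)
  have "(\<Sum>(u, v)\<leftarrow>splits (w # ws). d u v) = (\<Sum>(u, v)\<leftarrow>splits ws. d (w @ u) v + d u (w @ v))"
    by (simp add: comp_def case_prod_unfold sum_list_addf)
  also have "\<dots> = trace (word_matrix m w) * (\<Sum>(u, v)\<leftarrow>splits ws. d u v)"
    unfolding d by (simp add: case_prod_unfold sum_list_const_mult)
  finally show ?case using Cons.IH by (simp only: d_def list.map prod_list.Cons)
qed

text \<open>With x, y, z sent to e_11, e_12, e_21, the upper left entry of x u y v z is u_11 v_22
  and that of y u x v z is u_21 v_12; the difference is the determinant expression summed in
  \<open>sum_splits_eq_prod_trace\<close>.\<close>

definition trace_poly :: "'t \<times> nat \<Rightarrow> 't \<times> nat \<Rightarrow> 't \<times> nat \<Rightarrow> ('t \<times> nat) list list \<Rightarrow>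
    ('t, 'a::field) gr_poly" where
  "trace_poly x y z ws = (\<Sum>(u, v)\<leftarrow>splits ws.
     Poly_Mapping.single (x # u @ y # v @ [z]) 1 - Poly_Mapping.single (y # u @ x # v @ [z]) 1)"

lemma word_functional_trace_poly:
  "word_functional g (trace_poly x y z ws :: ('t, 'a::field) gr_poly) =
    (\<Sum>(u, v)\<leftarrow>splits ws. g (x # u @ y # v @ [z]) - g (y # u @ x # v @ [z]))"
proof -
  interpret l: Vector_Spaces.linear poly_scale "(*)" "word_functional g :: ('t, 'a) gr_poly \<Rightarrow> 'a"
    by (rule linear_word_functional)
  have "word_functional g (sum_list (fs :: ('t, 'a) gr_poly list)) = sum_list (map (word_functional g) fs)" for fs
    by (induction fs) (simp_all add: l.add)
  then show ?thesis
    by (simp add: trace_poly_def comp_def case_prod_unfold l.diff)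
qed

lemma word_matrix_trace_poly:
  fixes m :: "'t \<times> nat \<Rightarrow> 'a::field ^ 2 ^ 2"
  assumes "m x = matrix_unit 1 1" "m y = matrix_unit 1 2" "m z = matrix_unit 2 1"
  shows "word_functional (\<lambda>w. word_matrix m w $ 1 $ 1) (trace_poly x y z ws) =
    (\<Prod>w\<leftarrow>ws. trace (word_matrix m w))"
  unfolding word_functional_trace_poly sum_splits_eq_prod_trace[symmetric]
  using assms by (simp add: word_matrix_append matrix_mult_entry_2 matrix_mul_rid)

lemma multilinear_words_mset:
  "w \<in> multilinear_words n \<longleftrightarrow> mset (map snd w) = mset_set {1..n}"
proof
  assume "w \<in> multilinear_words n"
  then show "mset (map snd w) = mset_set {1..n}"
    using mset_set_set[of "map snd w"] by (auto simp: multilinear_words_def)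
next
  assume *: "mset (map snd w) = mset_set {1..n}"
  moreover have "mset [1..<Suc n] = mset_set {1..n}"
    by (simp only: mset_upt atLeastLessThanSuc_atLeastAtMost)
  ultimately have eq: "mset (map snd w) = mset [1..<Suc n]" by simp
  have "set (map snd w) = {1..n}" using mset_eq_setD[OF eq] by auto
  moreover have "distinct (map snd w)" using mset_eq_imp_distinct_iff[OF eq] by simp
  ultimately show "w \<in> multilinear_words n" by (simp add: multilinear_words_def)
qed

lemma trace_poly_multilinear:
  assumes ws: "mset (map snd (concat ws)) = mset_set {1..n}"
    and xyz: "snd x = n + 1" "snd y = n + 2" "snd z = n + 3"
  shows "trace_poly x y z ws \<in> (graded_multilinear (n + 3) :: ('t, 'a::field) gr_poly set)"
proof -
  interpret vector_space "poly_scale :: 'a \<Rightarrow> ('t, 'a) gr_poly \<Rightarrow> _"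
    by (rule vector_space_poly_scale)
  have set3: "{1..n+3} = insert (n+1) (insert (n+2) (insert (n+3) {1..n}))" by auto
  have "Poly_Mapping.single (x # u @ y # v @ [z]) 1 \<in> (graded_multilinear (n + 3) :: ('t, 'a) gr_poly set) \<and>
      Poly_Mapping.single (y # u @ x # v @ [z]) 1 \<in> (graded_multilinear (n + 3) :: ('t, 'a) gr_poly set)"
    if "(u, v) \<in> set (splits ws)" for u v
  proof -
    have "image_mset snd (mset u) + image_mset snd (mset v) = mset_set {1..n}"
      using mset_splits[OF that] ws by (metis image_mset_union mset_map)
    then have "x # u @ y # v @ [z] \<in> multilinear_words (n + 3)" "y # u @ x # v @ [z] \<in> multilinear_words (n + 3)"
      unfolding multilinear_words_mset set3 by (simp_all add: xyz)
    then show ?thesis unfolding graded_multilinear_eq_span by (auto intro!: span_base)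
  qed
  then have "f \<in> graded_multilinear (n + 3)" if "f \<in> set (map (\<lambda>(u, v).
      Poly_Mapping.single (x # u @ y # v @ [z]) 1 - Poly_Mapping.single (y # u @ x # v @ [z]) 1) (splits ws))"
      for f :: "('t, 'a) gr_poly"
    using that subspace_diff[OF subspace_graded_multilinear] by fastforce
  moreover have "sum_list fs \<in> graded_multilinear (n + 3)"
    if "\<And>f. f \<in> set fs \<Longrightarrow> f \<in> graded_multilinear (n + 3)" for fs :: "('t, 'a) gr_poly list"
    using that by (induction fs)
      (auto intro: subspace_add[OF subspace_graded_multilinear] subspace_0[OF subspace_graded_multilinear])
  ultimately show ?thesis unfolding trace_poly_def by blast
qed

text \<open>The last three variables have degree \<open>0\<close> and are evaluated at the units consumed by
  \<^const>\<open>trace_poly\<close>.\<close>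

definition extend_letters :: "nat \<Rightarrow> (nat \<Rightarrow> letter) \<Rightarrow> nat \<Rightarrow> letter" where
  "extend_letters n a i = (if i \<in> {1..n} then a i else if i = n + 2 then (0, 1, 2)
     else if i = n + 3 then (0, 2, 1) else (0, 1, 1))"

text \<open>Feed the cycles of \<open>\<sigma>\<close> to \<open>trace_poly\<close>, giving index
  \<open>i\<close> the degree \<open>t i\<close>. The traces test rows against columns, and the
  degrees written into the words test those of \<open>a\<close>.\<close>

lemma permutation_poly:
  assumes "\<sigma> permutes {1..n}"
  shows "\<exists>f \<in> (graded_multilinear (n + 3) :: (bit, 'a::field) gr_poly set). \<forall>a.
    word_functional (\<lambda>w. word_matrix (unit_subst (extend_letters n a)) w $ 1 $ 1) f =
      of_bool ((\<forall>i\<in>{1..n}. fst (a i) = t i) \<and>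
        (\<forall>j\<in>{1..n}. snd (snd (a j)) = fst (snd (a (\<sigma> j)))))"
proof -
  obtain ws where "permutation_words \<sigma> {1..n} ws TYPE('a)"
    using cycle_decomp_permutation_words[OF cycle_decomposition[OF assms]] by auto
  then have d: "distinct (concat ws)" and s: "set (concat ws) = {1..n}"
    and tr: "\<And>r c. (\<Prod>w\<leftarrow>ws. trace (word_matrix (\<lambda>i. matrix_unit (r i) (c i)) w)) =
        (of_bool (\<forall>j\<in>{1..n}. c j = r (\<sigma> j)) :: 'a)"
    by (auto simp: permutation_words_def)
  let ?typed = "map (map (\<lambda>i. (t i, i))) ws"
  let ?f = "trace_poly (0, n + 1) (0, n + 2) (0, n + 3) ?typed :: (bit, 'a) gr_poly"
  have "mset (map snd (concat ?typed)) = mset (concat ws)"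
    by (simp add: map_concat comp_def)
  also have "\<dots> = mset_set {1..n}" using d s by (metis mset_set_set)
  finally have mem: "?f \<in> graded_multilinear (n + 3)" by (rule trace_poly_multilinear) simp_all
  have val: "word_functional (\<lambda>w. word_matrix (unit_subst (extend_letters n a)) w $ 1 $ 1) ?f =
      of_bool ((\<forall>i\<in>{1..n}. fst (a i) = t i) \<and> (\<forall>j\<in>{1..n}. snd (snd (a j)) = fst (snd (a (\<sigma> j)))))"
    for a
  proof -
    let ?m = "unit_subst (extend_letters n a) :: _ \<Rightarrow> 'a ^ 2 ^ 2"
    let ?r = "\<lambda>i. fst (snd (a i))" and ?c = "\<lambda>i. snd (snd (a i))"
    have "word_functional (\<lambda>w. word_matrix ?m w $ 1 $ 1) ?f = (\<Prod>w\<leftarrow>?typed. trace (word_matrix ?m w))"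
      by (rule word_matrix_trace_poly) (simp_all add: unit_subst_def extend_letters_def)
    also have "\<dots> = (\<Prod>w\<leftarrow>ws. trace (word_matrix (\<lambda>i. ?m (t i, i)) w))"
    proof -
      have "word_matrix ?m (map (\<lambda>i. (t i, i)) w) = word_matrix (\<lambda>i. ?m (t i, i)) w" for w
        by (induction w) auto
      then show ?thesis by (simp add: comp_def)
    qed
    finally have eq: "word_functional (\<lambda>w. word_matrix ?m w $ 1 $ 1) ?f = \<dots>" .
    show ?thesis
    proof (cases "\<forall>i\<in>{1..n}. fst (a i) = t i")
      case True
      have "word_matrix (\<lambda>i. ?m (t i, i)) w = word_matrix (\<lambda>i. matrix_unit (?r i) (?c i)) w"
        if "w \<in> set ws" for w
      proof (rule word_matrix_cong)
        fix i assume "i \<in> set w"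
        then have i: "i \<in> {1..n}" using that s by auto
        show "?m (t i, i) = matrix_unit (?r i) (?c i)"
          using i True[rule_format, OF i] by (simp add: unit_subst_def extend_letters_def case_prod_beta)
      qed
      then have "(\<Prod>w\<leftarrow>ws. trace (word_matrix (\<lambda>i. ?m (t i, i)) w)) =
          (\<Prod>w\<leftarrow>ws. trace (word_matrix (\<lambda>i. matrix_unit (?r i) (?c i)) w))"
        by (intro arg_cong[where f = prod_list] map_cong refl) simp
      then show ?thesis using True unfolding eq tr by simp
    next
      case False
      \<comment> \<open>A variable of the wrong degree takes the value 0 and kills the trace of the
        cycle through it.\<close>
      then obtain i where i: "i \<in> {1..n}" "fst (a i) \<noteq> t i" by auto
      from i(1) have "i \<in> set (concat ws)" by (simp only: s)
      then obtain w where w: "w \<in> set ws" "i \<in> set w" by auto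
      have "word_matrix (\<lambda>i. ?m (t i, i)) w = 0"
        by (rule word_matrix_eq_0[OF w(2)])
          (use i in \<open>simp add: unit_subst_def extend_letters_def case_prod_beta\<close>)
      then have "trace (word_matrix (\<lambda>i. ?m (t i, i)) w) = 0"
        by (simp add: trace_2)
      then have "0 \<in> set (map (\<lambda>w. trace (word_matrix (\<lambda>i. ?m (t i, i)) w)) ws)"
        using w(1) by (metis (no_types, lifting) image_eqI list.set_map)
      then have zero: "(\<Prod>w\<leftarrow>ws. trace (word_matrix (\<lambda>i. ?m (t i, i)) w)) = 0"
        by (simp only: prod_list_zero_iff)
      show ?thesis unfolding eq zero using False by auto
    qed
  qed
  show ?thesis using mem val by blast
qed

section \<open>Alternating sums over swaps\<close>

text \<open>For \<open>\<beta>\<close> injective on \<open>E\<close> with image disjoint from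
  \<open>E\<close>, the product of the transpositions of \<open>b\<close> and
  \<open>\<beta> b\<close> over \<open>b \<in> E\<close>.\<close>

definition swap_along :: "('x \<Rightarrow> 'x) \<Rightarrow> 'x set \<Rightarrow> 'x \<Rightarrow> 'x" where
  "swap_along \<beta> E j = (if j \<in> E then \<beta> j else if j \<in> \<beta> ` E then inv_into E \<beta> j else j)"

lemma swap_along_involution:
  assumes "inj_on \<beta> E" "E \<inter> \<beta> ` E = {}"
  shows "swap_along \<beta> E (swap_along \<beta> E j) = j"
proof -
  consider "j \<in> E" | b where "j = \<beta> b" "b \<in> E" "\<beta> b \<notin> E" | "j \<notin> E" "j \<notin> \<beta> ` E"
    using assms(2) by blast
  then show ?thesis
  proof cases
    case 1
    then have "\<beta> j \<notin> E" using assms(2) by blast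
    then show ?thesis using 1 assms(1) by (simp add: swap_along_def)
  next
    case 2
    then show ?thesis using assms(1) by (simp add: swap_along_def)
  qed (simp add: swap_along_def)
qed

lemma swap_along_permutes:
  assumes "inj_on \<beta> E" "E \<inter> \<beta> ` E = {}" "E \<subseteq> S" "\<beta> ` E \<subseteq> S"
  shows "swap_along \<beta> E permutes S"
proof (rule bij_imp_permutes)
  have "bij (swap_along \<beta> E)"
    by (rule o_bij[where g = "swap_along \<beta> E"])
      (simp_all add: fun_eq_iff swap_along_involution[OF assms(1,2)])
  moreover have in_S: "swap_along \<beta> E j \<in> S" if "j \<in> S" for j
    using that assms inv_into_into[of j \<beta> E] by (auto simp: swap_along_def)
  ultimately show "bij_betw (swap_along \<beta> E) S S"
    using swap_along_involution[OF assms(1,2)]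
    by (intro bij_betwI[where g = "swap_along \<beta> E"]) auto
  show "swap_along \<beta> E j = j" if "j \<notin> S" for j
    using that assms by (auto simp: swap_along_def)
qed

text \<open>
  Swapping along a pair that \<open>J\<close> does not separate changes nothing but the sign, so only sets
  \<open>J\<close> meeting every pair once survive; their total height is less than that of \<open>I\<close>
  unless they are \<open>I\<close>. The same height argument applies to \<open>M\<close>.
\<close>

lemma sum_signed_swaps:
  fixes blk :: "'x \<Rightarrow> nat"
  assumes S: "finite S" and I: "I \<subseteq> S" and \<beta>: "inj_on \<beta> I" "\<beta> ` I \<subseteq> S - I"
    and blk: "\<And>b. b \<in> I \<Longrightarrow> blk (\<beta> b) + 1 = blk b"
    and J: "J \<subseteq> S" "card J = card I" "sum blk J = sum blk I"
    and M: "M \<subseteq> S" "sum blk M = sum blk I"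
  shows "(\<Sum>E\<in>Pow I. (-1) ^ card E * of_bool (\<forall>j\<in>S. j \<in> J \<longleftrightarrow> swap_along \<beta> E j \<in> M)) =
    (of_bool (J = I \<and> M = I) :: 'a::field_char_0)"
proof -
  have finI: "finite I" using S I by (rule finite_subset[rotated])
  define P where "P E \<longleftrightarrow> (\<forall>j\<in>S. j \<in> J \<longleftrightarrow> swap_along \<beta> E j \<in> M)" for E
  have inj: "inj_on \<beta> E" and disj: "E \<inter> \<beta> ` E = {}" if "E \<subseteq> I" for E
    using that \<beta> inj_on_subset by blast+
  \<comment> \<open>Each swapped element drops by one block, so the height falls by the number of
    swaps.\<close>
  have height: "sum blk ((I - E) \<union> \<beta> ` E) + card E = sum blk I"
    and card_flip: "card ((I - E) \<union> \<beta> ` E) = card I" if E: "E \<subseteq> I" for E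
  proof -
    have fin: "finite E" using E finI finite_subset by blast
    have d: "(I - E) \<inter> \<beta> ` E = {}" using E \<beta> by blast
    have "sum blk (\<beta> ` E) + card E = (\<Sum>b\<in>E. blk (\<beta> b) + 1)"
      using inj[OF E] by (simp add: sum.reindex sum_Suc)
    also have "\<dots> = sum blk E" using E blk by (intro sum.cong) auto
    finally show "sum blk ((I - E) \<union> \<beta> ` E) + card E = sum blk I"
      using d fin finI sum.subset_diff[OF E finI, of blk] by (simp add: sum.union_disjoint)
    show "card ((I - E) \<union> \<beta> ` E) = card I"
      using d fin finI card_mono[OF finI E]
      by (simp add: card_Un_disjoint card_image[OF inj[OF E]] card_Diff_subset E)
  qed
  show ?thesis
  proof (cases "\<exists>b\<in>I. b \<in> J \<longleftrightarrow> \<beta> b \<in> J")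
    case True
    then obtain b where b: "b \<in> I" "b \<in> J \<longleftrightarrow> \<beta> b \<in> J" by auto
    have bS: "b \<in> S" "\<beta> b \<in> S" "\<beta> b \<notin> I" using b(1) I \<beta> by auto
    \<comment> \<open>Inserting \<open>b\<close> only exchanges the images of \<open>b\<close> and
      \<open>\<beta> b\<close>, which \<open>J\<close> treats alike. Toggling \<open>b\<close> is
      thus a sign-reversing involution.\<close>
    have P_insert: "P (insert b E) \<longleftrightarrow> P E" if E: "E \<subseteq> I - {b}" for E
    proof -
      have bE: "b \<notin> E" "\<beta> b \<notin> \<beta> ` E" "b \<notin> \<beta> ` E" "\<beta> b \<notin> E"
        using E b(1) bS(3) \<beta>(2) inj_on_image_mem_iff[OF \<beta>(1) b(1), of E] by blast+
      have EI: "insert b E \<subseteq> I" "E \<subseteq> I" using E b(1) by auto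
      have new: "swap_along \<beta> (insert b E) b = \<beta> b" "swap_along \<beta> (insert b E) (\<beta> b) = b"
        using bE inv_into_f_f[OF inj[OF EI(1)], of b] bS b(1) by (auto simp: swap_along_def)
      have old: "swap_along \<beta> E b = b" "swap_along \<beta> E (\<beta> b) = \<beta> b"
        using bE by (auto simp: swap_along_def)
      have same: "swap_along \<beta> (insert b E) j = swap_along \<beta> E j" if "j \<noteq> b" "j \<noteq> \<beta> b" for j
      proof (cases "j \<in> \<beta> ` E")
        case True
        then obtain e where e: "e \<in> E" "j = \<beta> e" by auto
        have "inv_into (insert b E) \<beta> j = e" "inv_into E \<beta> j = e"
          using e inv_into_f_f[OF inj[OF EI(1)], of e] inv_into_f_f[OF inj[OF EI(2)], of e] by auto
        then show ?thesis using that True by (simp add: swap_along_def)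
      qed (use that in \<open>simp add: swap_along_def\<close>)
      show ?thesis
      proof -
        have split: "(\<forall>j\<in>S. Q j) \<longleftrightarrow> (\<forall>j\<in>S - {b, \<beta> b}. Q j) \<and> Q b \<and> Q (\<beta> b)" for Q
          using bS by blast
        show ?thesis unfolding P_def split[of "\<lambda>j. j \<in> J \<longleftrightarrow> _ j \<in> M"]
          using b(2) by (auto simp: new old same)
      qed
    qed
    have "(\<Sum>E\<in>Pow I. (-1) ^ card E * of_bool (P E)) =
        (\<Sum>E\<in>Pow (I - {b}). (-1) ^ card E * of_bool (P E)) +
        (\<Sum>E\<in>insert b ` Pow (I - {b}). (-1) ^ card E * (of_bool (P E) :: 'a))"
    proof -
      have I_eq: "Pow I = Pow (I - {b}) \<union> insert b ` Pow (I - {b})"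
        using Pow_insert[of b "I - {b}"] b(1) by (simp add: insert_absorb)
      show ?thesis
        by (subst I_eq, rule sum.union_disjoint) (use finI in auto)
    qed
    also have "(\<Sum>E\<in>insert b ` Pow (I - {b}). (-1) ^ card E * (of_bool (P E) :: 'a)) =
        (\<Sum>E\<in>Pow (I - {b}). (-1) ^ card (insert b E) * of_bool (P (insert b E)))"
      by (rule sum.reindex_cong[where l = "insert b"]) (auto simp: inj_on_def)
    also have "\<dots> = (\<Sum>E\<in>Pow (I - {b}). - ((-1) ^ card E * of_bool (P E)))"
    proof (rule sum.cong[OF refl])
      fix E assume E: "E \<in> Pow (I - {b})"
      then have "finite E" "b \<notin> E" using finI by (auto intro: finite_subset)
      then show "(-1) ^ card (insert b E) * of_bool (P (insert b E)) =
          - ((-1) ^ card E * (of_bool (P E) :: 'a))"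
        using P_insert[of E] E by simp
    qed
    finally have "(\<Sum>E\<in>Pow I. (-1) ^ card E * of_bool (P E)) = (0 :: 'a)"
      by (simp add: sum_negf)
    moreover have "J \<noteq> I" using b bS by auto
    ultimately show ?thesis by (simp add: P_def)
  next
    case False
    then have sep: "b \<in> J \<longleftrightarrow> \<beta> b \<notin> J" if "b \<in> I" for b using that by auto
    let ?E = "I - J"
    \<comment> \<open>\<open>J\<close> contains one element of each pair; equal cardinality leaves
      room for nothing else.\<close>
    have "(I - ?E) \<union> \<beta> ` ?E \<subseteq> J" using sep by auto
    then have J_eq: "(I - ?E) \<union> \<beta> ` ?E = J"
      using card_flip[of ?E] J S by (intro card_subset_eq) (auto intro: finite_subset)
    then have "card ?E = 0" using height[of ?E] J by simp
    then have "I \<subseteq> J" using finI by auto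
    then have JI: "J = I" using J S card_subset_eq[of J I] by (metis finite_subset)
    have P_iff: "P E \<longleftrightarrow> E = {} \<and> M = I" if E: "E \<in> Pow I" for E
    proof
      assume PE: "P E"
      have perm: "swap_along \<beta> E permutes S"
        using E I \<beta> inj[of E] disj[of E] by (intro swap_along_permutes) auto
      \<comment> \<open>With \<open>J = I\<close>, \<open>P E\<close> says that the swap carries
        \<open>I\<close> onto \<open>M\<close>; equal heights then force
        \<open>E = {}\<close>.\<close>
      have "M = swap_along \<beta> E ` I"
      proof
        show "swap_along \<beta> E ` I \<subseteq> M" using PE I by (auto simp: P_def JI)
        show "M \<subseteq> swap_along \<beta> E ` I"
        proof
          fix x assume x: "x \<in> M"
          then obtain j where j: "j \<in> S" "x = swap_along \<beta> E j"
            using M(1) permutes_image[OF perm] by blast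
          then have "j \<in> I" using PE x by (auto simp: P_def JI)
          then show "x \<in> swap_along \<beta> E ` I" using j by blast
        qed
      qed
      also have "\<dots> = (I - E) \<union> \<beta> ` E"
      proof -
        have "swap_along \<beta> E j = (if j \<in> E then \<beta> j else j)" if "j \<in> I" for j
          using that \<beta> E by (auto simp: swap_along_def)
        then have "swap_along \<beta> E ` I = (\<lambda>j. if j \<in> E then \<beta> j else j) ` I" by (rule image_cong[OF refl])
        also have "\<dots> = (I - E) \<union> \<beta> ` E" using E by auto
        finally show ?thesis .
      qed
      finally have M_eq: "M = (I - E) \<union> \<beta> ` E" .
      then have "card E = 0" using height[of E] E M by simp
      moreover have "finite E" using E finI finite_subset by auto
      ultimately show "E = {} \<and> M = I" using M_eq by auto
    next
      assume "E = {} \<and> M = I"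
      then show "P E" by (simp add: P_def JI swap_along_def)
    qed
    have "(\<Sum>E\<in>Pow I. (-1) ^ card E * (of_bool (P E) :: 'a)) =
        (\<Sum>E\<in>Pow I. if E = {} then of_bool (M = I) else 0)"
      using P_iff by (intro sum.cong) auto
    also have "\<dots> = of_bool (M = I)" using finI by (simp add: sum.delta)
    finally show ?thesis by (simp add: P_def JI)
  qed
qed

section \<open>Permutations and matchings adapted to blocks\<close>

lemma count_image_mset_set:
  assumes "finite A"
  shows "count (image_mset f (mset_set A)) y = card {x \<in> A. f x = y}"
proof -
  have "count (image_mset f (mset_set A)) y = (\<Sum>x | x \<in> A \<and> y = f x. count (mset_set A) x)"
    using assms by (simp add: count_image_mset')
  also have "\<dots> = (\<Sum>x | x \<in> A \<and> y = f x. 1)"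
    using assms by (intro sum.cong) auto
  also have "\<dots> = card {x. x \<in> A \<and> y = f x}" by simp
  also have "{x. x \<in> A \<and> y = f x} = {x \<in> A. f x = y}" by auto
  finally show ?thesis .
qed

lemma sum_eq_if_card_fibres_eq:
  fixes g :: "'b \<Rightarrow> 'c::comm_monoid_add"
  assumes "finite X" "finite Y" "\<And>j. card {i \<in> X. blk i = j} = card {i \<in> Y. blk i = j}"
  shows "(\<Sum>i\<in>X. g (blk i)) = (\<Sum>i\<in>Y. g (blk i))"
proof -
  have *: "image_mset blk (mset_set X) = image_mset blk (mset_set Y)"
    by (rule multiset_eqI) (simp add: count_image_mset_set assms)
  have "(\<Sum>i\<in>X. g (blk i)) = sum_mset (image_mset g (image_mset blk (mset_set X)))"
    by (simp add: sum_unfold_sum_mset image_mset.compositionality comp_def)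
  also have "\<dots> = (\<Sum>i\<in>Y. g (blk i))"
    unfolding * by (simp add: sum_unfold_sum_mset image_mset.compositionality comp_def)
  finally show ?thesis .
qed

text \<open>Label each point by its block and its membership in \<open>X\<close> or in
  \<open>Y\<close>. Both labellings use every label equally often, so a permutation carries one to
  the other.\<close>

lemma block_permutation:
  assumes S: "finite S" and X: "X \<subseteq> S" and Y: "Y \<subseteq> S"
    and card: "\<And>j. card {i \<in> X. blk i = j} = card {i \<in> Y. blk i = j}"
  shows "\<exists>\<pi>. \<pi> permutes S \<and> (\<forall>i\<in>S. blk (\<pi> i) = blk i \<and> (i \<in> X \<longleftrightarrow> \<pi> i \<in> Y))"
proof -
  have fin: "finite X" "finite Y" using S X Y finite_subset by blast+
  have "card {i \<in> S. (blk i, i \<in> X) = p} = card {i \<in> S. (blk i, i \<in> Y) = p}" for p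
  proof (cases p)
    case (Pair j t)
    have T: "{i \<in> S. blk i = j \<and> i \<in> Z} = {i \<in> Z. blk i = j}"
      and F: "{i \<in> S. blk i = j \<and> i \<notin> Z} = {i \<in> S. blk i = j} - {i \<in> Z. blk i = j}"
      if "Z \<subseteq> S" for Z using that by auto
    have "card {i \<in> S. blk i = j \<and> i \<notin> Z} = card {i \<in> S. blk i = j} - card {i \<in> Z. blk i = j}"
      if "Z \<subseteq> S" "finite Z" for Z
      unfolding F[OF that(1)] using that by (intro card_Diff_subset) auto
    then show ?thesis using card T[OF X] T[OF Y] X Y fin by (cases t) (simp_all add: Pair)
  qed
  then have "image_mset (\<lambda>i. (blk i, i \<in> X)) (mset_set S) = image_mset (\<lambda>i. (blk i, i \<in> Y)) (mset_set S)"
    by (intro multiset_eqI) (simp add: count_image_mset_set S)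
  then obtain \<pi> where "\<pi> permutes S" "\<forall>i\<in>S. (blk i, i \<in> X) = (blk (\<pi> i), \<pi> i \<in> Y)"
    by (rule image_mset_eq_implies_permutes[OF S])
  then show ?thesis by (intro exI[of _ \<pi>]) simp
qed

text \<open>Each block is injected into the free part of the preceding one, and the injections are
  glued. \<open>pos\<close> excludes block 0, which has no predecessor.\<close>

lemma block_matching:
  fixes blk :: "'x \<Rightarrow> nat"
  assumes S: "finite S" and I: "I \<subseteq> S" and pos: "\<And>i. i \<in> I \<Longrightarrow> blk i \<noteq> 0"
    and card: "\<And>j. card {i \<in> I. blk i = j + 1} \<le> card {i \<in> S - I. blk i = j}"
  shows "\<exists>\<beta>. inj_on \<beta> I \<and> \<beta> ` I \<subseteq> S - I \<and> (\<forall>b\<in>I. blk (\<beta> b) + 1 = blk b)"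
proof -
  have "\<exists>g. inj_on g {i \<in> I. blk i = j + 1} \<and> g ` {i \<in> I. blk i = j + 1} \<subseteq> {i \<in> S - I. blk i = j}" for j
  proof -
    have "finite I" using S I finite_subset by blast
    then have "finite {i \<in> I. blk i = j + 1}" "finite {i \<in> S - I. blk i = j}" using S by simp_all
    from card_le_inj[OF this card[of j]] show ?thesis by blast
  qed
  then have "\<forall>j. \<exists>g. inj_on g {i \<in> I. blk i = j + 1} \<and> g ` {i \<in> I. blk i = j + 1} \<subseteq> {i \<in> S - I. blk i = j}"
    by blast
  from choice[OF this] obtain g where inj: "\<And>j. inj_on (g j) {i \<in> I. blk i = j + 1}"
    and img: "\<And>j. g j ` {i \<in> I. blk i = j + 1} \<subseteq> {i \<in> S - I. blk i = j}" by blast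
  define \<beta> where "\<beta> b = g (blk b - 1) b" for b
  have mem: "\<beta> b \<in> S - I \<and> blk (\<beta> b) + 1 = blk b" if "b \<in> I" for b
  proof -
    have eq: "blk b = blk b - 1 + 1" using pos[OF that] by simp
    have "b \<in> {i \<in> I. blk i = blk b - 1 + 1}" using that eq by blast
    then have "\<beta> b \<in> {i \<in> S - I. blk i = blk b - 1}" unfolding \<beta>_def using img by blast
    then have "\<beta> b \<in> S - I" "blk (\<beta> b) = blk b - 1" by simp_all
    then show ?thesis using pos[OF that] by simp
  qed
  have "inj_on \<beta> I"
  proof
    fix b b' assume b: "b \<in> I" "b' \<in> I" "\<beta> b = \<beta> b'"
    then have eq: "blk b = blk b'" using mem[of b] mem[of b'] by metis
    show "b = b'"
    proof (rule inj_onD[OF inj[of "blk b - 1"]])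
      show "g (blk b - 1) b = g (blk b - 1) b'" using b(3) eq by (simp add: \<beta>_def)
      have "blk b = blk b - 1 + 1" using pos[OF b(1)] by simp
      then show "b \<in> {i \<in> I. blk i = blk b - 1 + 1}" "b' \<in> {i \<in> I. blk i = blk b - 1 + 1}"
        using b(1,2) eq by (metis (mono_tags, lifting) mem_Collect_eq)+
    qed
  qed
  then show ?thesis using mem by blast
qed

section \<open>The lower bound\<close>

lemma eq_iff_eq_2: "x = y \<longleftrightarrow> (x = 2 \<longleftrightarrow> y = 2)" for x y :: 2
  using exhaust_2[of x] exhaust_2[of y] by auto

text \<open>
  The first block must be large enough to be matched with the second one; this is
  the case \<open>j = 0\<close> of \<open>big\<close>, where \<open>m 0 = 0\<close>.
\<close>

locale block_family =
  fixes n :: nat and blk m :: "nat \<Rightarrow> nat" and \<Omega> :: "(nat \<Rightarrow> letter) set"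
  assumes m0: "m 0 = 0" and big: "m j + m (j + 1) \<le> card {i \<in> {1..n}. blk i = j}"
    and \<Omega>: "\<Omega> \<subseteq> {1..n} \<rightarrow>\<^sub>E letters"
    and rows: "a \<in> \<Omega> \<Longrightarrow> card {i \<in> {1..n}. fst (snd (a i)) = 2 \<and> blk i = j} = m j"
    and cols: "a \<in> \<Omega> \<Longrightarrow> card {i \<in> {1..n}. snd (snd (a i)) = 2 \<and> blk i = j} = m j"
begin

definition row2 where "row2 a = {i \<in> {1..n}. fst (snd (a i)) = (2 :: 2)}" for a :: "nat \<Rightarrow> letter"
definition col2 where "col2 a = {i \<in> {1..n}. snd (snd (a i)) = (2 :: 2)}" for a :: "nat \<Rightarrow> letter"

lemma card_row2: "a \<in> \<Omega> \<Longrightarrow> card {i \<in> row2 a. blk i = j} = m j"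
  using rows[of a j] by (simp add: row2_def conj_assoc)

lemma card_col2: "a \<in> \<Omega> \<Longrightarrow> card {i \<in> col2 a. blk i = j} = m j"
  using cols[of a j] by (simp add: col2_def conj_assoc)

lemma letter_fun_eq:
  assumes "a \<in> \<Omega>" "a' \<in> \<Omega>" "\<forall>i\<in>{1..n}. fst (a i) = fst (a' i)" "row2 a = row2 a'" "col2 a = col2 a'"
  shows "a = a'"
proof (rule PiE_ext)
  show "a \<in> {1..n} \<rightarrow>\<^sub>E letters" "a' \<in> {1..n} \<rightarrow>\<^sub>E letters" using assms \<Omega> by auto
  fix i assume i: "i \<in> {1..n}"
  have "fst (snd (a i)) = fst (snd (a' i))" "snd (snd (a i)) = snd (snd (a' i))"
    using assms(4,5) i by (subst eq_iff_eq_2, auto simp: row2_def col2_def)+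
  then show "a i = a' i" using assms(3) i by (simp add: prod_eq_iff)
qed

text \<open>The signed sum of the permutation polynomials for
  \<open>\<pi> \<circ> swap_along \<beta> E\<close>; \<open>sum_signed_swaps\<close> collapses its
  value to the single assignment \<open>a\<close>.\<close>

lemma dual_poly:
  assumes a: "a \<in> \<Omega>"
  shows "\<exists>f \<in> (graded_multilinear (n + 3) :: (bit, 'a::field_char_0) gr_poly set). \<forall>a'\<in>\<Omega>.
    word_functional (\<lambda>w. word_matrix (unit_subst (extend_letters n a')) w $ 1 $ 1) f = of_bool (a' = a)"
proof -
  interpret vector_space "poly_scale :: 'a \<Rightarrow> (bit, 'a) gr_poly \<Rightarrow> _"
    by (rule vector_space_poly_scale)
  let ?S = "{1..n}" and ?I = "col2 a"
  have I: "?I \<subseteq> ?S" and R: "row2 a \<subseteq> ?S" and finI: "finite ?I"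
    unfolding row2_def col2_def by auto
  \<comment> \<open>A base permutation detecting \<open>a\<close>; it preserves blocks so that
    pulling sets back along it keeps their heights.\<close>
  have "\<exists>\<pi>. \<pi> permutes ?S \<and> (\<forall>i\<in>?S. blk (\<pi> i) = blk i \<and> (i \<in> col2 a \<longleftrightarrow> \<pi> i \<in> row2 a))"
    by (rule block_permutation[OF _ I R]) (simp_all add: card_row2[OF a] card_col2[OF a])
  then obtain \<pi> where \<pi>: "\<pi> permutes ?S" "\<And>i. i \<in> ?S \<Longrightarrow> blk (\<pi> i) = blk i"
      "\<And>i. i \<in> ?S \<Longrightarrow> i \<in> col2 a \<longleftrightarrow> \<pi> i \<in> row2 a"
    by blast
  \<comment> \<open>Positions with column 2 are paired with positions of column 1 one block lower;
    \<open>big\<close> provides the room.\<close>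
  have "\<exists>\<beta>. inj_on \<beta> ?I \<and> \<beta> ` ?I \<subseteq> ?S - ?I \<and> (\<forall>b\<in>?I. blk (\<beta> b) + 1 = blk b)"
  proof (rule block_matching)
    show "blk i \<noteq> 0" if "i \<in> ?I" for i
    proof
      assume "blk i = 0"
      then have "i \<in> {i \<in> ?I. blk i = 0}" using that by simp
      moreover have "{i \<in> ?I. blk i = 0} = {}" using card_col2[OF a, of 0] finI m0 by simp
      ultimately show False by blast
    qed
    show "card {i \<in> ?I. blk i = j + 1} \<le> card {i \<in> ?S - ?I. blk i = j}" for j
    proof -
      have "{i \<in> ?S - ?I. blk i = j} = {i \<in> ?S. blk i = j} - {i \<in> ?I. blk i = j}" by auto
      then have "card {i \<in> ?S - ?I. blk i = j} = card {i \<in> ?S. blk i = j} - card {i \<in> ?I. blk i = j}"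
        using finI I by (simp add: card_Diff_subset subset_iff)
      then show ?thesis using big[of j] card_col2[OF a, of j] card_col2[OF a, of "j + 1"] by simp
    qed
  qed (use I in auto)
  then obtain \<beta> where \<beta>: "inj_on \<beta> ?I" "\<beta> ` ?I \<subseteq> ?S - ?I"
    and \<beta>_blk: "\<And>b. b \<in> ?I \<Longrightarrow> blk (\<beta> b) + 1 = blk b" by blast
  have swap: "swap_along \<beta> E permutes ?S" if "E \<subseteq> ?I" for E
  proof (rule swap_along_permutes)
    show "inj_on \<beta> E" by (rule inj_on_subset[OF \<beta>(1) that])
  qed (use that \<beta>(2) I in blast)+
  have "\<forall>E\<in>Pow ?I. \<exists>f. f \<in> (graded_multilinear (n + 3) :: (bit, 'a) gr_poly set) \<and> (\<forall>a'.
      word_functional (\<lambda>w. word_matrix (unit_subst (extend_letters n a')) w $ 1 $ 1) f =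
        of_bool ((\<forall>i\<in>?S. fst (a' i) = fst (a i)) \<and>
          (\<forall>j\<in>?S. snd (snd (a' j)) = fst (snd (a' ((\<pi> \<circ> swap_along \<beta> E) j))))))"
  proof
    fix E assume "E \<in> Pow ?I"
    then have "E \<subseteq> ?I" by simp
    from permutation_poly[OF permutes_compose[OF swap[OF this] \<pi>(1)], where t = "\<lambda>i. fst (a i)"]
    show "\<exists>f. f \<in> (graded_multilinear (n + 3) :: (bit, 'a) gr_poly set) \<and> (\<forall>a'.
      word_functional (\<lambda>w. word_matrix (unit_subst (extend_letters n a')) w $ 1 $ 1) f =
        of_bool ((\<forall>i\<in>?S. fst (a' i) = fst (a i)) \<and>
          (\<forall>j\<in>?S. snd (snd (a' j)) = fst (snd (a' ((\<pi> \<circ> swap_along \<beta> E) j))))))"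
      by blast
  qed
  from bchoice[OF this] obtain f where
    "\<forall>E\<in>Pow ?I. f E \<in> (graded_multilinear (n + 3) :: (bit, 'a) gr_poly set) \<and> (\<forall>a'.
      word_functional (\<lambda>w. word_matrix (unit_subst (extend_letters n a')) w $ 1 $ 1) (f E) =
        of_bool ((\<forall>i\<in>?S. fst (a' i) = fst (a i)) \<and>
          (\<forall>j\<in>?S. snd (snd (a' j)) = fst (snd (a' ((\<pi> \<circ> swap_along \<beta> E) j))))))"
    by blast
  then have f: "\<And>E. E \<in> Pow ?I \<Longrightarrow> f E \<in> (graded_multilinear (n + 3) :: (bit, 'a) gr_poly set)"
    and val: "\<And>E a'. E \<in> Pow ?I \<Longrightarrow>
      word_functional (\<lambda>w. word_matrix (unit_subst (extend_letters n a')) w $ 1 $ 1) (f E) =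
        of_bool ((\<forall>i\<in>?S. fst (a' i) = fst (a i)) \<and>
          (\<forall>j\<in>?S. snd (snd (a' j)) = fst (snd (a' ((\<pi> \<circ> swap_along \<beta> E) j)))))"
    by blast+
  let ?F = "\<Sum>E\<in>Pow ?I. poly_scale ((-1) ^ card E) (f E)"
  have "?F \<in> graded_multilinear (n + 3)"
    by (intro subspace_sum[OF subspace_graded_multilinear] subspace_scale[OF subspace_graded_multilinear] f)
  moreover have "word_functional (\<lambda>w. word_matrix (unit_subst (extend_letters n a')) w $ 1 $ 1) ?F =
      of_bool (a' = a)" if a': "a' \<in> \<Omega>" for a'
  proof -
    interpret l: Vector_Spaces.linear poly_scale "(*)"
      "word_functional (\<lambda>w. word_matrix (unit_subst (extend_letters n a')) w $ 1 $ 1) :: (bit, 'a) gr_poly \<Rightarrow> 'a"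
      by (rule linear_word_functional)
    \<comment> \<open>Pulling the rows of \<open>a'\<close> back along \<open>\<pi>\<close> leaves a
      condition on the swap alone.\<close>
    define M where "M = {j \<in> ?S. \<pi> j \<in> row2 a'}"
    let ?T = "\<forall>i\<in>?S. fst (a' i) = fst (a i)"
    have "row2 a' \<subseteq> \<pi> ` ?S" unfolding permutes_image[OF \<pi>(1)] row2_def by blast
    then have \<pi>M: "\<pi> ` M = row2 a'" unfolding M_def by blast
    have same: "X \<subseteq> ?S \<Longrightarrow> (\<And>j. card {i \<in> X. blk i = j} = m j) \<Longrightarrow> sum blk X = sum blk ?I"
      for X
      using sum_eq_if_card_fibres_eq[of X ?I blk "\<lambda>x. x"] finI card_col2[OF a]
      by (simp add: finite_subset)
    have sumM: "sum blk M = sum blk ?I"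
    proof -
      have "sum blk M = sum blk (row2 a')"
        unfolding \<pi>M[symmetric] using permutes_inj_on[OF \<pi>(1)] \<pi>(2)
        by (subst sum.reindex) (auto simp: M_def)
      also have "\<dots> = sum blk ?I" using card_row2[OF a'] by (intro same) (auto simp: row2_def)
      finally show ?thesis .
    qed
    have sumJ: "sum blk (col2 a') = sum blk ?I"
      using card_col2[OF a'] by (intro same) (auto simp: col2_def)
    have cardJ: "card (col2 a') = card ?I"
      using sum_eq_if_card_fibres_eq[of "col2 a'" ?I blk "\<lambda>_. 1 :: nat"] finI card_col2[OF a] card_col2[OF a']
      by (simp add: col2_def)
    have cond: "(\<forall>j\<in>?S. snd (snd (a' j)) = fst (snd (a' ((\<pi> \<circ> swap_along \<beta> E) j)))) \<longleftrightarrow>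
        (\<forall>j\<in>?S. j \<in> col2 a' \<longleftrightarrow> swap_along \<beta> E j \<in> M)" if "E \<subseteq> ?I" for E
    proof (rule ball_cong[OF refl])
      fix j assume j: "j \<in> ?S"
      then have "swap_along \<beta> E j \<in> ?S" "\<pi> (swap_along \<beta> E j) \<in> ?S"
        using permutes_in_image[OF swap[OF that]] permutes_in_image[OF \<pi>(1)] by blast+
      then show "snd (snd (a' j)) = fst (snd (a' ((\<pi> \<circ> swap_along \<beta> E) j))) \<longleftrightarrow>
          (j \<in> col2 a' \<longleftrightarrow> swap_along \<beta> E j \<in> M)"
        using j by (subst eq_iff_eq_2) (simp add: M_def row2_def col2_def)
    qed
    have "word_functional (\<lambda>w. word_matrix (unit_subst (extend_letters n a')) w $ 1 $ 1) ?F =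
        (\<Sum>E\<in>Pow ?I. (-1) ^ card E * (of_bool (?T \<and> (\<forall>j\<in>?S. j \<in> col2 a' \<longleftrightarrow> swap_along \<beta> E j \<in> M)) :: 'a))"
      unfolding l.sum l.scale by (intro sum.cong refl) (simp only: val cond Pow_iff)
    also have "\<dots> = of_bool ?T *
        (\<Sum>E\<in>Pow ?I. (-1) ^ card E * of_bool (\<forall>j\<in>?S. j \<in> col2 a' \<longleftrightarrow> swap_along \<beta> E j \<in> M))"
      by (cases ?T) simp_all
    also have "(\<Sum>E\<in>Pow ?I. (-1) ^ card E * of_bool (\<forall>j\<in>?S. j \<in> col2 a' \<longleftrightarrow> swap_along \<beta> E j \<in> M)) =
        (of_bool (col2 a' = ?I \<and> M = ?I) :: 'a)"
    proof (rule sum_signed_swaps[where blk = blk, OF _ I \<beta> \<beta>_blk _ cardJ sumJ _ sumM])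
      show "col2 a' \<subseteq> ?S" "M \<subseteq> ?S" unfolding col2_def M_def by blast+
    qed simp
    also have "of_bool ?T * of_bool (col2 a' = ?I \<and> M = ?I) = (of_bool (a' = a) :: 'a)"
    proof -
      \<comment> \<open>Applying \<open>\<pi>\<close> turns the equality of pulled-back sets into
        one of rows.\<close>
      have "row2 a' = row2 a" if "M = ?I"
      proof -
        have "row2 a \<subseteq> \<pi> ` ?S" unfolding permutes_image[OF \<pi>(1)] by (rule R)
        then have "row2 a = \<pi> ` ?I" using \<pi>(3) I by blast
        then show ?thesis using \<pi>M that by simp
      qed
      moreover have "M = ?I" if "a' = a" using \<pi>(3) I that unfolding M_def by blast
      ultimately have "?T \<and> col2 a' = ?I \<and> M = ?I \<longleftrightarrow> a' = a"
        using letter_fun_eq[OF a' a] by blast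
      then show ?thesis unfolding of_bool_conj[symmetric] by (rule arg_cong)
    qed
    finally show ?thesis .
  qed
  ultimately show ?thesis by blast
qed

text \<open>Evaluations at \<open>\<Omega>\<close> and the polynomials of \<open>dual_poly\<close>
  form a dual system; the evaluations kill identities because the extended letters respect the
  grading.\<close>

lemma card_le_graded_codim:
  "card \<Omega> \<le> graded_codim (pair_scale :: 'a::field_char_0 \<Rightarrow> _) pair_mult T1_gr (n + 3)"
proof -
  have "\<forall>a\<in>\<Omega>. \<exists>f. f \<in> (graded_multilinear (n + 3) :: (bit, 'a) gr_poly set) \<and> (\<forall>a'\<in>\<Omega>.
    word_functional (\<lambda>w. word_matrix (unit_subst (extend_letters n a')) w $ 1 $ 1) f = of_bool (a' = a))"
    using dual_poly[where 'a = 'a] by blast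
  from bchoice[OF this] obtain F where F: "\<forall>a\<in>\<Omega>.
    F a \<in> (graded_multilinear (n + 3) :: (bit, 'a) gr_poly set) \<and> (\<forall>a'\<in>\<Omega>.
      word_functional (\<lambda>w. word_matrix (unit_subst (extend_letters n a')) w $ 1 $ 1) (F a) = of_bool (a' = a))"
    by blast
  have n: "n + 3 \<ge> 1" by simp
  have fin: "finite \<Omega>" by (rule finite_subset[OF \<Omega>]) (simp add: finite_PiE finite_letters)
  show ?thesis unfolding graded_codim_def
  proof (rule dim_quotient_space_ge[OF vector_space_poly_scale subspace_graded_multilinear
        subspace_multilinear_identities[OF n] graded_codim_le_card_balanced_words(1)[OF n] fin,
        where f = F and
        \<phi> = "\<lambda>a. word_functional (\<lambda>w. word_matrix (unit_subst (extend_letters n a)) w $ 1 $ 1)"])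
    fix a and f :: "(bit, 'a) gr_poly" assume a: "a \<in> \<Omega>"
      and f: "f \<in> graded_multilinear (n + 3) \<inter> graded_identities pair_scale pair_mult T1_gr"
    have letter: "extend_letters n a i \<in> letters" for i
    proof (cases "i \<in> {1..n}")
      case True
      have "a \<in> {1..n} \<rightarrow>\<^sub>E letters" using a \<Omega> by blast
      from PiE_mem[OF this True] show ?thesis using True by (simp add: extend_letters_def)
    next
      case False
      then show ?thesis by (simp only: extend_letters_def if_False) (simp add: letters_def)
    qed
    have ut: "unit_subst (extend_letters n a) (1, i) $ 2 $ 1 = (0 :: 'a)" for i
    proof -
      obtain t r c where l: "extend_letters n a i = (t, r, c)" by (metis prod_cases3)
      then have "\<not> (t = 1 \<and> r = 2 \<and> c = 1)"
        using letter[of i] by (simp add: letters_def)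
      then show ?thesis by (auto simp: unit_subst_def l)
    qed
    from f have "\<forall>m p q. (\<forall>i. m (1, i) $ 2 $ 1 = 0) \<longrightarrow>
        word_functional (\<lambda>w. word_matrix m w $ p $ q) f = 0"
      using graded_identity_iff[of f "n + 3"] n by blast
    from this[rule_format, of "unit_subst (extend_letters n a)" 1 1, OF ut]
    show "word_functional (\<lambda>w. word_matrix (unit_subst (extend_letters n a)) w $ 1 $ 1) f = (0 :: 'a)" .
  next
    fix a a' assume "a \<in> \<Omega>" "a' \<in> \<Omega>"
    then show "word_functional (\<lambda>w. word_matrix (unit_subst (extend_letters n a)) w $ 1 $ 1) (F a') =
        of_bool (a = a')" using F by blast
  qed (use F in blast, rule linear_word_functional)
qed

end

section \<open>Counting balanced blocks\<close>

text \<open>Positions start at 0 so that blocks can be strung together by \<open>div\<close> and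
  \<open>mod\<close>.\<close>

definition balanced_blocks :: "nat \<Rightarrow> (nat \<Rightarrow> letter) set" where
  "balanced_blocks h = {z \<in> {..<2 * h} \<rightarrow>\<^sub>E letters.
     card {k \<in> {..<2 * h}. fst (snd (z k)) = 2} = h \<and> card {k \<in> {..<2 * h}. snd (snd (z k)) = 2} = h}"

lemma finite_balanced_blocks: "finite (balanced_blocks h)"
  unfolding balanced_blocks_def
  by (rule finite_subset[of _ "{..<2 * h} \<rightarrow>\<^sub>E letters"]) (auto simp: finite_PiE finite_letters)

text \<open>
  A balanced block is determined by the set \<open>I\<close> of positions in row \<open>2\<close>, the sets \<open>A \<subseteq> I\<close> and
  \<open>B\<close> in the complement of \<open>I\<close> of the positions off the diagonal, and the set \<open>K\<close> of positions of
  degree \<open>1\<close>, which has to avoid \<open>A\<close>.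
\<close>

lemma card_balanced_blocks_ge:
  "(2 * h choose h) * (\<Sum>a\<le>h. (h choose a) * (h choose a) * 2 ^ (2 * h - a)) \<le> card (balanced_blocks h)"
proof -
  let ?U = "{..<2 * h}"
  let ?X = "SIGMA I : {I. I \<subseteq> ?U \<and> card I = h}. SIGMA a : {..h}.
      SIGMA A : {A. A \<subseteq> I \<and> card A = a}. SIGMA B : {B. B \<subseteq> ?U - I \<and> card B = a}. Pow (?U - A)"
  \<comment> \<open>\<open>A\<close> holds the units e_21 and \<open>B\<close> the units e_12; as
    they are equally many, the columns are balanced like the rows.\<close>
  let ?z = "\<lambda>(I, a :: nat, A, B, K) k. if k \<in> ?U then
      (if k \<in> K then 1 else 0, if k \<in> I then 2 else 1, if k \<in> (I - A) \<union> B then 2 else 1) else undefined :: letter"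
  have fin: "finite I" "finite (?U - I)" if "I \<subseteq> ?U" for I
    using that finite_subset by auto
  have inner: "card (SIGMA a : {..h}. SIGMA A : {A. A \<subseteq> I \<and> card A = a}.
        SIGMA B : {B. B \<subseteq> ?U - I \<and> card B = a}. Pow (?U - A)) =
      (\<Sum>a\<le>h. (h choose a) * (h choose a) * 2 ^ (2 * h - a))"
    if I: "I \<subseteq> ?U" "card I = h" for I
  proof -
    have fI: "finite {A. A \<subseteq> I \<and> card A = a}" and fJ: "finite {B. B \<subseteq> ?U - I \<and> card B = a}" for a
      using fin[OF I(1)] by simp_all
    have cI: "card (?U - I) = h" using I by (simp add: card_Diff_subset fin)
    have "card (SIGMA B : {B. B \<subseteq> ?U - I \<and> card B = a}. Pow (?U - A)) = (h choose a) * 2 ^ (2 * h - a)"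
      if A: "A \<subseteq> I" "card A = a" for A a
    proof -
      have "card (?U - A) = 2 * h - a"
        using A I fin[of A] by (subst card_Diff_subset) auto
      then show ?thesis
        using fJ fin(2)[OF I(1)] by (simp add: card_Pow n_subsets cI)
    qed
    then have "card (SIGMA A : {A. A \<subseteq> I \<and> card A = a}.
        SIGMA B : {B. B \<subseteq> ?U - I \<and> card B = a}. Pow (?U - A)) =
        (\<Sum>A | A \<subseteq> I \<and> card A = a. (h choose a) * 2 ^ (2 * h - a))" for a
      using fI fJ by (subst card_SigmaI) auto
    then show ?thesis
      using fI fJ fin(1)[OF I(1)] by (subst card_SigmaI) (auto simp: n_subsets I mult.assoc)
  qed
  have "card ?X = (\<Sum>I | I \<subseteq> ?U \<and> card I = h. \<Sum>a\<le>h. (h choose a) * (h choose a) * 2 ^ (2 * h - a))"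
  proof (subst card_SigmaI)
    show "\<forall>I\<in>{I. I \<subseteq> ?U \<and> card I = h}. finite (SIGMA a : {..h}. SIGMA A : {A. A \<subseteq> I \<and> card A = a}.
        SIGMA B : {B. B \<subseteq> ?U - I \<and> card B = a}. Pow (?U - A))"
    proof
      fix I assume "I \<in> {I. I \<subseteq> ?U \<and> card I = h}"
      then show "finite (SIGMA a : {..h}. SIGMA A : {A. A \<subseteq> I \<and> card A = a}.
        SIGMA B : {B. B \<subseteq> ?U - I \<and> card B = a}. Pow (?U - A))"
        using fin[of I] by (intro finite_SigmaI) simp_all
    qed
  qed (use inner in simp_all)
  then have card_X: "card ?X = (2 * h choose h) * (\<Sum>a\<le>h. (h choose a) * (h choose a) * 2 ^ (2 * h - a))"
    by (simp add: n_subsets)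
  have "inj_on ?z ?X"
  proof
    fix x x' assume x: "x \<in> ?X" "x' \<in> ?X" and eq: "?z x = ?z x'"
    obtain I a A B K I' a' A' B' K' where xs: "x = (I, a, A, B, K)" "x' = (I', a', A', B', K')"
      by (cases x, cases x') auto
    have sub: "I \<subseteq> ?U" "A \<subseteq> I" "B \<subseteq> ?U - I" "K \<subseteq> ?U" "I' \<subseteq> ?U" "A' \<subseteq> I'" "B' \<subseteq> ?U - I'" "K' \<subseteq> ?U"
      and a: "card A = a" "card A' = a'"
      using x by (auto simp: xs)
    have "(k \<in> K \<longleftrightarrow> k \<in> K') \<and> (k \<in> I \<longleftrightarrow> k \<in> I') \<and> (k \<in> (I - A) \<union> B \<longleftrightarrow> k \<in> (I' - A') \<union> B')"
      if "k \<in> ?U" for k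
    proof (intro conjI)
      have e: "?z x k = ?z x' k" using eq by (rule fun_cong)
      have "(if k \<in> K then 1 else 0 :: bit) = (if k \<in> K' then 1 else 0)"
        using arg_cong[OF e, of fst] that by (simp only: xs prod.case if_True fst_conv)
      then show "k \<in> K \<longleftrightarrow> k \<in> K'" by (simp split: if_splits)
      have "(if k \<in> I then 2 else 1 :: 2) = (if k \<in> I' then 2 else 1)"
        using arg_cong[OF e, of "\<lambda>l. fst (snd l)"] that by (simp only: xs prod.case if_True fst_conv snd_conv)
      then show "k \<in> I \<longleftrightarrow> k \<in> I'" by (simp split: if_splits)
      have "(if k \<in> (I - A) \<union> B then 2 else 1 :: 2) = (if k \<in> (I' - A') \<union> B' then 2 else 1)"
        using arg_cong[OF e, of "\<lambda>l. snd (snd l)"] that by (simp only: xs prod.case if_True snd_conv)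
      then show "k \<in> (I - A) \<union> B \<longleftrightarrow> k \<in> (I' - A') \<union> B'" by (simp only: split: if_splits) simp_all
    qed
    then have iff: "K = K'" "I = I'" and cols: "k \<in> ?U \<Longrightarrow> k \<in> (I - A) \<union> B \<longleftrightarrow> k \<in> (I' - A') \<union> B'" for k
      using sub by blast+
    \<comment> \<open>Inside \<open>I\<close> the column set shows \<open>I - A\<close>, outside it
      shows \<open>B\<close>.\<close>
    have "A = A'" "B = B'" using cols sub unfolding iff by blast+
    then show "x = x'" using iff a by (simp add: xs)
  qed
  moreover have "?z ` ?X \<subseteq> balanced_blocks h"
  proof
    fix z assume "z \<in> ?z ` ?X"
    then obtain I a A B K where z: "z = ?z (I, a, A, B, K)" and I: "I \<subseteq> ?U" "card I = h"
      and A: "A \<subseteq> I" "card A = a" and B: "B \<subseteq> ?U - I" "card B = a" and K: "K \<subseteq> ?U - A"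
      by auto
    have "{k \<in> ?U. fst (snd (z k)) = 2} = I" using I by (auto simp: z)
    moreover have "{k \<in> ?U. snd (snd (z k)) = 2} = (I - A) \<union> B" using I A B by (auto simp: z)
    moreover have "card ((I - A) \<union> B) = h"
    proof -
      have "finite I" "finite A" "finite B"
        using fin[OF I(1)] A B finite_subset by blast+
      moreover have "(I - A) \<inter> B = {}" using B by blast
      ultimately have "card ((I - A) \<union> B) = card I - card A + card B"
        using A by (simp add: card_Un_disjoint card_Diff_subset)
      then show ?thesis using card_mono[OF \<open>finite I\<close> A(1)] A B I by simp
    qed
    moreover have "z \<in> ?U \<rightarrow>\<^sub>E letters"
    proof (rule PiE_I)
      show "z k \<in> letters" if "k \<in> ?U" for k
        using that K A B I by (auto simp: z letters_def)
    qed (simp add: z)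
    ultimately show "z \<in> balanced_blocks h" using I by (simp add: balanced_blocks_def)
  qed
  ultimately have "card ?X \<le> card (balanced_blocks h)"
    by (intro card_inj_on_le[OF _ _ finite_balanced_blocks])
  then show ?thesis by (simp only: card_X)
qed

text \<open>The central binomial coefficient is at least 4^h / (2h). By Cauchy-Schwarz the sum of
  squares over \<open>h + 1\<close> terms is at least (2 + sqrt 2)^(2h) / (h + 1).\<close>

lemma card_balanced_blocks_real_ge:
  assumes h: "h > 0"
  shows "(4 + 2 * sqrt 2) ^ (2 * h) / (2 * real h * (real h + 1)) \<le> real (card (balanced_blocks h))"
proof -
  \<comment> \<open>The square roots of the summands; unlike these, they sum by the binomial
    theorem.\<close>
  let ?f = "\<lambda>a. real (h choose a) * (2 ^ h * (1 / sqrt 2) ^ a)"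
  have "(\<Sum>a\<le>h. ?f a) = 2 ^ h * (1 / sqrt 2 + 1) ^ h"
    by (subst binomial_ring) (simp add: sum_distrib_left mult_ac)
  also have "\<dots> = (2 + sqrt 2) ^ h"
    by (simp add: power_mult_distrib[symmetric] field_simps)
  finally have sum_f: "(\<Sum>a\<le>h. ?f a) = (2 + sqrt 2) ^ h" .
  have "((2 + sqrt 2) ^ h)\<^sup>2 \<le> (\<Sum>a\<le>h. (?f a)\<^sup>2) * (real h + 1)"
    using sum_squared_le_sum_of_squares[of ?f "{..h}"] unfolding sum_f by (simp add: add.commute)
  also have "(\<Sum>a\<le>h. (?f a)\<^sup>2) = (\<Sum>a\<le>h. real (h choose a) * real (h choose a) * 2 ^ (2 * h - a))"
  proof (rule sum.cong[OF refl])
    fix a assume "a \<in> {..h}"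
    then have "2 ^ (2 * h) = (2 ^ (2 * h - a) * 2 ^ a :: real)"
      by (simp add: power_add[symmetric])
    moreover have "((1 / sqrt 2) ^ a)\<^sup>2 = (1 / 2 :: real) ^ a"
      by (simp only: power_even_eq[symmetric] power_mult) (simp add: power_divide)
    ultimately have "(2 ^ h * (1 / sqrt 2) ^ a)\<^sup>2 = (2 ^ (2 * h - a) * 2 ^ a * (1 / 2) ^ a :: real)"
      by (simp only: power_mult_distrib power_even_eq[symmetric])
    also have "\<dots> = 2 ^ (2 * h - a)" by (simp add: power_divide)
    finally have "(2 ^ h * (1 / sqrt 2) ^ a)\<^sup>2 = (2 ^ (2 * h - a) :: real)" .
    then show "(?f a)\<^sup>2 = real (h choose a) * real (h choose a) * 2 ^ (2 * h - a)"
      by (simp add: power_mult_distrib power2_eq_square)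
  qed
  finally have 1: "((2 + sqrt 2) ^ h)\<^sup>2 / (real h + 1) \<le>
      (\<Sum>a\<le>h. real (h choose a) * real (h choose a) * 2 ^ (2 * h - a))"
    by (simp add: field_simps)
  have "(4 + 2 * sqrt 2)\<^sup>2 = 4 * (2 + sqrt 2)\<^sup>2" by (simp add: power2_eq_square field_simps)
  then have "(4 + 2 * sqrt 2) ^ (2 * h) = 4 ^ h * ((2 + sqrt 2)\<^sup>2) ^ h"
    by (simp only: power_mult power_mult_distrib)
  also have "((2 + sqrt 2)\<^sup>2) ^ h = ((2 + sqrt 2) ^ h)\<^sup>2"
    by (simp only: power_mult[symmetric] mult.commute)
  finally have "(4 + 2 * sqrt 2) ^ (2 * h) / (2 * real h * (real h + 1)) =
      4 ^ h / (2 * real h) * (((2 + sqrt 2) ^ h)\<^sup>2 / (real h + 1))"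
    by simp
  also have "\<dots> \<le> real (2 * h choose h) * (\<Sum>a\<le>h. real (h choose a) * real (h choose a) * 2 ^ (2 * h - a))"
    using central_binomial_lower_bound[OF h] 1 by (intro mult_mono) auto
  also have "\<dots> = real ((2 * h choose h) * (\<Sum>a\<le>h. (h choose a) * (h choose a) * 2 ^ (2 * h - a)))"
    by simp
  also have "\<dots> \<le> real (card (balanced_blocks h))"
    using card_balanced_blocks_ge[of h] by (simp only: of_nat_le_iff)
  finally show ?thesis .
qed

text \<open>The first \<open>n\<^sub>0\<close> places are filled with e_11, which has neither row
  nor column 2; they make up block 0.\<close>

definition concat_blocks :: "nat \<Rightarrow> nat \<Rightarrow> nat \<Rightarrow> (nat \<Rightarrow> nat \<Rightarrow> letter) \<Rightarrow> nat \<Rightarrow> letter" where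
  "concat_blocks n\<^sub>0 h q g i = (if i \<in> {1..n\<^sub>0 + q * (2 * h)} then
     if i \<le> n\<^sub>0 then (0, 1, 1) else g ((i - n\<^sub>0 - 1) div (2 * h)) ((i - n\<^sub>0 - 1) mod (2 * h))
     else undefined)"

definition block_index :: "nat \<Rightarrow> nat \<Rightarrow> nat \<Rightarrow> nat" where
  "block_index n\<^sub>0 h i = (if i \<le> n\<^sub>0 then 0 else Suc ((i - n\<^sub>0 - 1) div (2 * h)))"

text \<open>\<open>P\<close> is left open so that one statement serves rows, columns and block
  lengths.\<close>

lemma block_decomposition:
  assumes h: "h > 0"
  shows "{i \<in> {1..n\<^sub>0 + q * (2 * h)}. P i \<and> block_index n\<^sub>0 h i = Suc j} =
    (if j < q then (\<lambda>k. n\<^sub>0 + 1 + j * (2 * h) + k) ` {k \<in> {..<2 * h}. P (n\<^sub>0 + 1 + j * (2 * h) + k)} else {})"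
    (is "?L = ?R")
proof -
  have lt: "d * (2 * h) + k < q * (2 * h)" if "d < q" "k < 2 * h" for d k :: nat
  proof -
    have "d * (2 * h) + k < Suc d * (2 * h)" using that by simp
    also have "\<dots> \<le> q * (2 * h)" using that by (intro mult_right_mono) auto
    finally show ?thesis .
  qed
  have L: "i \<in> ?L \<longleftrightarrow> (\<exists>k<2 * h. j < q \<and> i = n\<^sub>0 + 1 + j * (2 * h) + k \<and> P i)" for i
  proof
    assume "i \<in> ?L"
    then have i: "n\<^sub>0 < i" "i \<le> n\<^sub>0 + q * (2 * h)" "(i - n\<^sub>0 - 1) div (2 * h) = j" "P i"
      by (auto simp: block_index_def split: if_splits)
    have "i - n\<^sub>0 - 1 < q * (2 * h)" using i by linarith
    then have "j < q" using i(3) h by (simp add: less_mult_imp_div_less flip: i(3))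
    moreover have "i = n\<^sub>0 + 1 + j * (2 * h) + (i - n\<^sub>0 - 1) mod (2 * h)"
      using div_mult_mod_eq[of "i - n\<^sub>0 - 1" "2 * h"] i(1) unfolding i(3) by linarith
    moreover have "(i - n\<^sub>0 - 1) mod (2 * h) < 2 * h" using h by simp
    ultimately show "\<exists>k<2 * h. j < q \<and> i = n\<^sub>0 + 1 + j * (2 * h) + k \<and> P i" using i(4) by blast
  next
    assume "\<exists>k<2 * h. j < q \<and> i = n\<^sub>0 + 1 + j * (2 * h) + k \<and> P i"
    then obtain k where k: "k < 2 * h" "j < q" "i = n\<^sub>0 + 1 + j * (2 * h) + k" "P i" by blast
    have "block_index n\<^sub>0 h i = Suc j" using k h by (simp add: block_index_def)
    moreover have "i \<in> {1..n\<^sub>0 + q * (2 * h)}" using k lt[OF k(2,1)] by simp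
    ultimately show "i \<in> ?L" using k(4) by blast
  qed
  show ?thesis by (rule Set.set_eqI) (unfold L, auto)
qed

lemma concat_blocks_nth:
  assumes "h > 0" "j < q" "k < 2 * h"
  shows "concat_blocks n\<^sub>0 h q g (n\<^sub>0 + 1 + j * (2 * h) + k) = g j k"
proof -
  have "j * (2 * h) + k < Suc j * (2 * h)" using assms by simp
  also have "\<dots> \<le> q * (2 * h)" using assms by (intro mult_right_mono) auto
  finally show ?thesis using assms by (simp add: concat_blocks_def)
qed

text \<open>Blocks are filled independently, hence the power. Block 0 needs \<open>h\<close> places
  to receive the column-2 positions of block 1.\<close>

lemma card_balanced_blocks_power_le_graded_codim:
  assumes h: "h > 0" and n0: "h \<le> n\<^sub>0"
  shows "card (balanced_blocks h) ^ q \<le>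
    graded_codim (pair_scale :: 'a::field_char_0 \<Rightarrow> _) pair_mult T1_gr (n\<^sub>0 + q * (2 * h) + 3)"
proof -
  let ?n = "n\<^sub>0 + q * (2 * h)" and ?G = "{..<q} \<rightarrow>\<^sub>E balanced_blocks h"
  let ?blk = "block_index n\<^sub>0 h" and ?c = "concat_blocks n\<^sub>0 h q"
  let ?m = "\<lambda>j. if 0 < j \<and> j \<le> q then h else 0"
  have mem: "g j k \<in> letters" if "g \<in> ?G" "j < q" "k < 2 * h" for g j k
    using that by (auto simp: balanced_blocks_def PiE_iff Pi_iff)
  have card: "card {i \<in> {1..?n}. P (?c g i) \<and> ?blk i = j} = ?m j"
    if g: "g \<in> ?G" and P: "\<not> P (0, 1, 1)"
      and bal: "\<And>z. z \<in> balanced_blocks h \<Longrightarrow> card {k \<in> {..<2 * h}. P (z k)} = h" for g P j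
  proof (cases j)
    case 0
    then have "{i \<in> {1..?n}. P (?c g i) \<and> ?blk i = j} = {}"
      using P by (auto simp: block_index_def concat_blocks_def split: if_splits)
    then show ?thesis using 0 by simp
  next
    case (Suc d)
    show ?thesis
    proof (cases "d < q")
      case True
      have "{k \<in> {..<2 * h}. P (?c g (n\<^sub>0 + 1 + d * (2 * h) + k))} = {k \<in> {..<2 * h}. P (g d k)}"
        using concat_blocks_nth[OF h True] by auto
      moreover have "card {k \<in> {..<2 * h}. P (g d k)} = h" using g True by (intro bal) auto
      ultimately show ?thesis
        using True unfolding Suc block_decomposition[OF h, of n\<^sub>0 q "\<lambda>i. P (?c g i)"]
        by (simp add: card_image inj_on_def)
    next
      case False
      then show ?thesis unfolding Suc block_decomposition[OF h, of n\<^sub>0 q "\<lambda>i. P (?c g i)"] by simp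
    qed
  qed
  interpret block_family ?n ?blk ?m "?c ` ?G"
  proof
    show "?m j + ?m (j + 1) \<le> card {i \<in> {1..?n}. ?blk i = j}" for j
    proof (cases j)
      case 0
      have "card {1..n\<^sub>0} \<le> card {i \<in> {1..?n}. ?blk i = j}"
        by (rule card_mono) (auto simp: 0 block_index_def)
      then show ?thesis using 0 n0 by simp
    next
      \<comment> \<open>The length \<open>2 * h\<close> of a block is just enough for its own
        \<open>h\<close> positions and the \<open>h\<close> of its successor.\<close>
      case (Suc d)
      then show ?thesis
        using block_decomposition[OF h, of n\<^sub>0 q "\<lambda>_. True" d]
        by (auto simp: card_image inj_on_def)
    qed
    show "?c ` ?G \<subseteq> {1..?n} \<rightarrow>\<^sub>E letters"
    proof (intro image_subsetI PiE_I)
      fix g i assume g: "g \<in> ?G" and i: "i \<in> {1..?n}"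
      show "?c g i \<in> letters"
      proof (cases "i \<le> n\<^sub>0")
        case True
        then show ?thesis using i by (simp add: concat_blocks_def letters_def)
      next
        case False
        then have "i - n\<^sub>0 - 1 < q * (2 * h)" using i by auto
        then have "(i - n\<^sub>0 - 1) div (2 * h) < q" by (rule less_mult_imp_div_less)
        then have "g ((i - n\<^sub>0 - 1) div (2 * h)) ((i - n\<^sub>0 - 1) mod (2 * h)) \<in> letters"
          using h by (intro mem[OF g]) simp_all
        then show ?thesis using False i by (simp add: concat_blocks_def)
      qed
    next
      fix g i assume "i \<notin> {1..?n}"
      then show "?c g i = undefined" by (simp only: concat_blocks_def if_False)
    qed
    fix a j assume "a \<in> ?c ` ?G"
    then obtain g where g: "g \<in> ?G" "a = ?c g" by auto
    show "card {i \<in> {1..?n}. fst (snd (a i)) = 2 \<and> ?blk i = j} = ?m j"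
      unfolding g(2) by (rule card[OF g(1)]) (simp_all add: balanced_blocks_def)
    show "card {i \<in> {1..?n}. snd (snd (a i)) = 2 \<and> ?blk i = j} = ?m j"
      unfolding g(2) by (rule card[OF g(1)]) (simp_all add: balanced_blocks_def)
  qed simp
  have "inj_on ?c ?G"
  proof
    fix g g' assume g: "g \<in> ?G" "g' \<in> ?G" "?c g = ?c g'"
    show "g = g'"
    proof (rule PiE_ext[OF g(1,2)])
      fix j assume "j \<in> {..<q}"
      then have j: "j < q" by simp
      have "g j \<in> {..<2 * h} \<rightarrow>\<^sub>E letters" "g' j \<in> {..<2 * h} \<rightarrow>\<^sub>E letters"
        using PiE_mem[OF g(1)] PiE_mem[OF g(2)] j by (auto simp: balanced_blocks_def)
      then show "g j = g' j"
      proof (rule PiE_ext)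
        fix k assume "k \<in> {..<2 * h}"
        then show "g j k = g' j k"
          using concat_blocks_nth[OF h j, of k] g(3) by (metis lessThan_iff)
      qed
    qed
  qed
  then have "card (?c ` ?G) = card (balanced_blocks h) ^ q"
    by (simp add: card_image card_PiE)
  then show ?thesis using card_le_graded_codim[where 'a = 'a] by simp
qed

section \<open>The exponent\<close>

text \<open>Fix the block length first, large enough that the polynomial loss per block is harmless,
  and only then let the number of blocks grow.\<close>

lemma eventually_root_graded_codim_gt:
  assumes b: "b < 4 + 2 * sqrt 2"
  shows "\<forall>\<^sub>F n in sequentially.
    b < root n (real (graded_codim (pair_scale :: 'a::field_char_0 \<Rightarrow> _) pair_mult T1_gr n))"
proof -
  let ?c = "\<lambda>n. real (graded_codim (pair_scale :: 'a \<Rightarrow> _) pair_mult T1_gr n)"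
  have "(\<lambda>h. (4 + 2 * sqrt 2) * (2 * real h * (real h + 1)) powr (- 1 / (2 * real h)))
      \<longlonglongrightarrow> (4 + 2 * sqrt 2) * 1"
    by (intro tendsto_mult tendsto_const) real_asymp
  then have "\<forall>\<^sub>F h in sequentially.
      b < (4 + 2 * sqrt 2) * (2 * real h * (real h + 1)) powr (- 1 / (2 * real h))"
    using b by (intro order_tendstoD(1)) auto
  then obtain h where h: "h > 0"
    and bh: "b < (4 + 2 * sqrt 2) * (2 * real h * (real h + 1)) powr (- 1 / (2 * real h))"
    using eventually_happens'[OF _ eventually_conj[OF _ eventually_gt_at_top[of "0 :: nat"]]]
    by (metis (mono_tags, lifting) sequentially_bot)
  define Z where "Z = real (card (balanced_blocks h))"
  have Z_ge: "(4 + 2 * sqrt 2) ^ (2 * h) / (2 * real h * (real h + 1)) \<le> Z"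
    unfolding Z_def by (rule card_balanced_blocks_real_ge[OF h])
  have "0 < (4 + 2 * sqrt 2) ^ (2 * h) / (2 * real h * (real h + 1))"
    using h by (intro divide_pos_pos mult_pos_pos zero_less_power add_pos_nonneg) auto
  then have "Z > 0" using Z_ge by linarith
  then have "card (balanced_blocks h) \<ge> 1" unfolding Z_def by simp
  then have Z1: "Z \<ge> 1" unfolding Z_def by simp
  have "(4 + 2 * sqrt 2) * (2 * real h * (real h + 1)) powr (- 1 / (2 * real h)) =
      ((4 + 2 * sqrt 2) ^ (2 * h) / (2 * real h * (real h + 1))) powr (1 / (2 * real h))"
  proof -
    have "((4 + 2 * sqrt 2) ^ (2 * h)) powr (1 / (2 * real h)) = 4 + 2 * sqrt 2"
      using h by (subst powr_realpow[symmetric]) (auto simp: powr_powr intro!: add_pos_nonneg)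
    then show ?thesis
      by (simp add: powr_divide powr_minus_divide)
  qed
  also have "\<dots> \<le> Z powr (1 / (2 * real h))"
    using Z_ge h by (intro powr_mono2) (auto intro!: divide_nonneg_nonneg mult_nonneg_nonneg)
  finally have b_Z: "b < Z powr (1 / (2 * real h))" using bh by linarith
  \<comment> \<open>The quotient bounds \<open>q / n\<close> from below, where \<open>q\<close>
    blocks fit into \<open>n\<close>: at most \<open>3 * h\<close> places are filler and 3 are the
    extra variables.\<close>
  have "(\<lambda>n. (real n - 3 - 3 * real h) / (2 * real h * real n)) \<longlonglongrightarrow> inverse (real h) / 2"
    using h by real_asymp
  moreover have "inverse (real h) / 2 = 1 / (2 * real h)" by (simp add: inverse_eq_divide)
  ultimately have "(\<lambda>n. (real n - 3 - 3 * real h) / (2 * real h * real n)) \<longlonglongrightarrow> 1 / (2 * real h)"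
    by (simp only:)
  then have "(\<lambda>n. Z powr ((real n - 3 - 3 * real h) / (2 * real h * real n))) \<longlonglongrightarrow> Z powr (1 / (2 * real h))"
    using Z1 by (intro tendsto_powr tendsto_const) auto
  then have "\<forall>\<^sub>F n in sequentially. b < Z powr ((real n - 3 - 3 * real h) / (2 * real h * real n))"
    using b_Z by (rule order_tendstoD(1))
  moreover have "Z powr ((real n - 3 - 3 * real h) / (2 * real h * real n)) \<le> root n (?c n)"
    if n: "n \<ge> 3 + h" for n
  proof -
    define q where "q = (n - 3 - h) div (2 * h)"
    \<comment> \<open>The filler absorbs the remainder, and the additional \<open>h\<close> secures
      \<open>h \<le> n\<^sub>0\<close>.\<close>
    define n\<^sub>0 where "n\<^sub>0 = h + (n - 3 - h) mod (2 * h)"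
    have n_eq: "n = n\<^sub>0 + q * (2 * h) + 3"
      using div_mult_mod_eq[of "n - 3 - h" "2 * h"] n unfolding q_def n\<^sub>0_def by linarith
    have "Z ^ q \<le> ?c n"
      using card_balanced_blocks_power_le_graded_codim[OF h, of n\<^sub>0 q, where 'a = 'a]
      unfolding n_eq Z_def of_nat_power[symmetric] of_nat_le_iff by (simp add: n\<^sub>0_def)
    have "n\<^sub>0 < 3 * h" using h by (simp add: n\<^sub>0_def)
    then have "real n\<^sub>0 \<le> 3 * real h" by linarith
    moreover have "real n = real n\<^sub>0 + real q * (2 * real h) + 3" by (simp add: n_eq)
    ultimately have "real n - 3 - 3 * real h \<le> real q * (2 * real h)" by linarith
    then have "(real n - 3 - 3 * real h) / (2 * real h * real n) \<le> real q * (2 * real h) / (2 * real h * real n)"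
      by (rule divide_right_mono) simp
    also have "\<dots> = real q * (1 / real n)" using h by simp
    finally have "Z powr ((real n - 3 - 3 * real h) / (2 * real h * real n)) \<le> Z powr (real q * (1 / real n))"
      using Z1 by (intro powr_mono) auto
    also have "\<dots> = (Z powr real q) powr (1 / real n)" by (simp only: powr_powr)
    also have "\<dots> = (Z ^ q) powr (1 / real n)"
      using Z1 by (subst powr_realpow) auto
    also have "\<dots> = root n (Z ^ q)"
      using Z1 n by (subst root_powr_inverse) auto
    also have "\<dots> \<le> root n (?c n)"
      using \<open>Z ^ q \<le> ?c n\<close> n by (intro real_root_le_mono) auto
    finally show ?thesis .
  qed
  then have "\<forall>\<^sub>F n in sequentially. Z powr ((real n - 3 - 3 * real h) / (2 * real h * real n)) \<le> root n (?c n)"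
    using eventually_ge_at_top by (rule eventually_mono[rotated])
  ultimately show ?thesis by eventually_elim linarith
qed

text \<open>The constant factor \<open>4 * sqrt 2\<close> in the upper bound disappears since its
  \<open>n\<close>-th root tends to 1.\<close>

lemma eventually_root_graded_codim_lt:
  assumes b: "4 + 2 * sqrt 2 < b"
  shows "\<forall>\<^sub>F n in sequentially.
    root n (real (graded_codim (pair_scale :: 'a::field \<Rightarrow> _) pair_mult T1_gr n)) < b"
proof -
  have "(\<lambda>n. root n (4 * sqrt 2) * (4 + 2 * sqrt 2)) \<longlonglongrightarrow> 1 * (4 + 2 * sqrt 2)"
    by (intro tendsto_mult LIMSEQ_root_const tendsto_const) simp
  then have "\<forall>\<^sub>F n in sequentially. root n (4 * sqrt 2) * (4 + 2 * sqrt 2) < b"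
    using b by (intro order_tendstoD(2)) auto
  moreover have "\<forall>\<^sub>F n :: nat in sequentially. n \<ge> 1" by (rule eventually_ge_at_top)
  ultimately show ?thesis
  proof eventually_elim
    case (elim n)
    have "real (graded_codim (pair_scale :: 'a \<Rightarrow> _) pair_mult T1_gr n) \<le> real (4 * card (balanced_words n))"
      using graded_codim_le_card_balanced_words(2)[OF elim(2), where 'a = 'a] by (simp only: of_nat_le_iff)
    also have "\<dots> \<le> 4 * sqrt 2 * (4 + 2 * sqrt 2) ^ n"
      using card_balanced_words_le[of n] by simp
    finally have "root n (real (graded_codim (pair_scale :: 'a \<Rightarrow> _) pair_mult T1_gr n)) \<le>
        root n (4 * sqrt 2 * (4 + 2 * sqrt 2) ^ n)"
      using elim(2) by (intro real_root_le_mono) auto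
    also have "\<dots> = root n (4 * sqrt 2) * (4 + 2 * sqrt 2)"
      using elim(2) by (simp add: real_root_mult real_root_power_cancel)
    finally show ?case using elim(1) by linarith
  qed
qed

theorem theorem3:
  shows "(\<lambda>n. root n (real (graded_codim
            (pair_scale :: 'a::field_char_0 \<Rightarrow> _) pair_mult T1_gr n)))
          \<longlonglongrightarrow> 4 + 2 * sqrt 2"
  by (rule order_tendstoI) (fact eventually_root_graded_codim_gt eventually_root_graded_codim_lt)+

end
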